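(* There exists a positive operator $T_0\in\mathcal M_{1,\infty}$ which is not Dixmier measurable, but such that all $\mathrm{Tr}_\omega\in\mathcal D_P$ take the same value on $T_0$.
   Context: $L_\infty=L_\infty(0,\infty)$ is the space of real-valued bounded Lebesgue measurable functions on $(0,\infty)$ with the essential supremum norm. A generalized limit is a positive linear functional $\omega$ on $L_\infty$, normalized ($\omega(1)=1$), which equals the ordinary limit on functions convergent at $+\infty$. It is dilation invariant if $\omega(x(\beta\,\cdot))=\omega(x)$ for all $x\in L_\infty$ and $\beta>0$, and exponentiation invariant if $\omega(P^ax)=\omega(x)$ for all $x\in L_\infty$ and $a>0$, where $(P^ax)(t)=x(t^a)$. $H$ is a separable infinite-dimensional (complex) Hilbert space, $B(H)$ the algebra of bounded linear operators on $H$, $\mathrm{Tr}$ the standard trace. For $T\in B(H)$, $\mu(t,T)=\inf\{\|Tp\| : p\in B(H)\text{ a projection with }\mathrm{Tr}(1-p)\le t\}$. The Dixmier ideal is $$\mathcal M_{1,\infty}=\left\{T\in B(H):\ \sup_{t>0}\frac1{\log(1+t)}\int_0^t\mu(s,T)\,ds<\infty\right\}.$$ For a dilation invariant or an exponentiation invariant generalized limit $\omega$, the formula $$\mathrm{Tr}_\omega(T)=\omega\left(\frac{1}{\log(1+t)}\int_0^t\mu(s,T)\,ds\right),\qquad 0\le T\in\mathcal M_{1,\infty},$$ is additive on the positive cone, and $\mathrm{Tr}_\omega$ denotes its linear extension to $\mathcal M_{1,\infty}$. $\mathcal D$ (the set of all Dixmier traces) is the set of all $\mathrm{Tr}_\omega$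 with $\omega$ dilation invariant; $\mathcal D_P$ is the set of all $\mathrm{Tr}_\omega$ with $\omega$ exponentiation invariant. An operator $T\in\mathcal M_{1,\infty}$ is Dixmier measurable if $\mathrm{Tr}_\omega(T)$ takes the same value for all $\mathrm{Tr}_\omega\in\mathcal D$. *)

theory Defs
  imports "HOL-Analysis.Analysis"
begin

section \<open>Complex Hilbert spaces\<close>

text \<open>
  The inner product is conjugate-linear in its first argument.  Positivity and definiteness
  of the inner product follow from the last axiom, which ties it to the (complete) norm.
\<close>

class chilbert_space = banach +
  fixes scaleC :: "complex \<Rightarrow> 'a \<Rightarrow> 'a" (infixr "*\<^sub>C" 75)
    and cinner :: "'a \<Rightarrow> 'a \<Rightarrow> complex"
  assumes scaleC_add_right: "c *\<^sub>C (x + y) = c *\<^sub>C x + c *\<^sub>C y"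
    and scaleC_add_left: "(c + d) *\<^sub>C x = c *\<^sub>C x + d *\<^sub>C x"
    and scaleC_scaleC: "c *\<^sub>C d *\<^sub>C x = (c * d) *\<^sub>C x"
    and scaleR_scaleC: "scaleR r x = complex_of_real r *\<^sub>C x"
    and cinner_commute: "cinner x y = cnj (cinner y x)"
    and cinner_add_right: "cinner x (y + z) = cinner x y + cinner x z"
    and cinner_scaleC_right: "cinner x (c *\<^sub>C y) = c * cinner x y"
    and cinner_self: "cinner x x = complex_of_real ((norm x)\<^sup>2)"

global_interpretation complex_vector: vector_space "scaleC :: complex \<Rightarrow> 'a \<Rightarrow> 'a::chilbert_space"
  defines cspan = complex_vector.span
proof unfold_locales
  fix x :: 'a
  show "1 *\<^sub>C x = x"
    using scaleR_scaleC[of 1 x] by simp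
qed (simp_all add: scaleC_add_right scaleC_add_left scaleC_scaleC)

definition orthonormal_basis :: "'a::chilbert_space set \<Rightarrow> bool" where
  "orthonormal_basis B \<longleftrightarrow>
     (\<forall>e\<in>B. norm e = 1) \<and> (\<forall>e\<in>B. \<forall>f\<in>B. e \<noteq> f \<longrightarrow> cinner e f = 0) \<and>
     closure (cspan B) = UNIV"


section \<open>Bounded operators\<close>

text \<open>
  The elements of the library type of bounded linear maps are only real-linear; \<open>BH\<close> singles
  out the complex-linear ones.  The norm of that type is the operator norm.
\<close>

definition BH :: "('a::chilbert_space \<Rightarrow>\<^sub>L 'a) set" where
  "BH = {T. \<forall>c x. blinfun_apply T (c *\<^sub>C x) = c *\<^sub>C blinfun_apply T x}"

definition positive_op :: "('a::chilbert_space \<Rightarrow>\<^sub>L 'a) \<Rightarrow> bool" where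
  "positive_op T \<longleftrightarrow> T \<in> BH \<and> (\<forall>x. cinner x (blinfun_apply T x) \<in> \<real>\<^sub>\<ge>\<^sub>0)"

definition projection_op :: "('a::chilbert_space \<Rightarrow>\<^sub>L 'a) \<Rightarrow> bool" where
  "projection_op p \<longleftrightarrow> p \<in> BH \<and> p o\<^sub>L p = p \<and>
     (\<forall>x y. cinner (blinfun_apply p x) y = cinner x (blinfun_apply p y))"

text \<open>
  The standard trace of a positive operator, with values in \<open>[0,\<infinity>]\<close>.  It does not depend on the
  orthonormal basis that is used.
\<close>

definition pos_trace :: "('a::chilbert_space \<Rightarrow>\<^sub>L 'a) \<Rightarrow> ennreal" where
  "pos_trace A =
     (\<Sum>\<^sub>\<infinity>e\<in>(SOME B. orthonormal_basis B). ennreal (Re (cinner e (blinfun_apply A e))))"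

definition mu :: "real \<Rightarrow> ('a::chilbert_space \<Rightarrow>\<^sub>L 'a) \<Rightarrow> real" where
  "mu t T = Inf {norm (T o\<^sub>L p) |p. projection_op p \<and> pos_trace (id_blinfun - p) \<le> ennreal t}"

definition log_mean :: "('a::chilbert_space \<Rightarrow>\<^sub>L 'a) \<Rightarrow> real \<Rightarrow> real" where
  "log_mean T t = 1 / ln (1 + t) * (LBINT s:{0..t}. mu s T)"

definition dixmier_ideal :: "('a::chilbert_space \<Rightarrow>\<^sub>L 'a) set" where
  "dixmier_ideal = {T \<in> BH. bdd_above (log_mean T ` {0<..})}"


section \<open>Generalized limits\<close>

text \<open>
  Elements of \<open>L\<^sub>\<infinity>(0,\<infinity>)\<close> are represented by functions on the real line, whose values outside
  \<open>(0,\<infinity>)\<close> are irrelevant.  Functionals on \<open>L\<^sub>\<infinity>(0,\<infinity>)\<close> are functionals on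
  representatives that respect equality almost everywhere.
\<close>

definition Linf :: "(real \<Rightarrow> real) set" where
  "Linf = {x \<in> borel_measurable (lebesgue_on {0<..}).
             \<exists>C. AE t in lebesgue_on {0<..}. \<bar>x t\<bar> \<le> C}"

definition generalized_limit :: "((real \<Rightarrow> real) \<Rightarrow> real) \<Rightarrow> bool" where
  "generalized_limit \<omega> \<longleftrightarrow>
     (\<forall>x\<in>Linf. \<forall>y\<in>Linf. (AE t in lebesgue_on {0<..}. x t = y t) \<longrightarrow> \<omega> x = \<omega> y) \<and>
     (\<forall>x\<in>Linf. \<forall>y\<in>Linf. \<omega> (\<lambda>t. x t + y t) = \<omega> x + \<omega> y) \<and>
     (\<forall>c. \<forall>x\<in>Linf. \<omega> (\<lambda>t. c * x t) = c * \<omega> x) \<and>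
     (\<forall>x\<in>Linf. (AE t in lebesgue_on {0<..}. 0 \<le> x t) \<longrightarrow> 0 \<le> \<omega> x) \<and>
     \<omega> (\<lambda>t. 1) = 1 \<and>
     (\<forall>x\<in>Linf. \<forall>l. (x \<longlongrightarrow> l) at_top \<longrightarrow> \<omega> x = l)"

definition dilation_invariant :: "((real \<Rightarrow> real) \<Rightarrow> real) \<Rightarrow> bool" where
  "dilation_invariant \<omega> \<longleftrightarrow> (\<forall>x\<in>Linf. \<forall>\<beta>>0. \<omega> (\<lambda>t. x (\<beta> * t)) = \<omega> x)"

definition exponentiation_invariant :: "((real \<Rightarrow> real) \<Rightarrow> real) \<Rightarrow> bool" where
  "exponentiation_invariant \<omega> \<longleftrightarrow> (\<forall>x\<in>Linf. \<forall>a>0. \<omega> (\<lambda>t. x (t powr a)) = \<omega> x)"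


section \<open>Dixmier traces\<close>

text \<open>
  On the positive cone of the ideal the trace is \<open>\<omega>\<close> of the logarithmic mean.  This is additive
  there when \<open>\<omega>\<close> is dilation invariant or exponentiation invariant, so that on the remaining
  operators the value of the linear extension does not depend on the chosen decomposition into
  positive operators.  Outside of the ideal the trace is undefined.
\<close>

definition ideal_decomposition ::
    "('a::chilbert_space \<Rightarrow>\<^sub>L 'a) \<Rightarrow> ('a \<Rightarrow>\<^sub>L 'a) \<Rightarrow> ('a \<Rightarrow>\<^sub>L 'a) \<Rightarrow> ('a \<Rightarrow>\<^sub>L 'a) \<Rightarrow> ('a \<Rightarrow>\<^sub>L 'a) \<Rightarrow> bool"
  where
  "ideal_decomposition T A B C D \<longleftrightarrow>
     (\<forall>S\<in>{A, B, C, D}. S \<in> dixmier_ideal \<and> positive_op S) \<and>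
     (\<forall>x. blinfun_apply T x = blinfun_apply A x - blinfun_apply B x
            + \<i> *\<^sub>C (blinfun_apply C x - blinfun_apply D x))"

definition Tr :: "((real \<Rightarrow> real) \<Rightarrow> real) \<Rightarrow> ('a::chilbert_space \<Rightarrow>\<^sub>L 'a) \<Rightarrow> complex" where
  "Tr \<omega> = (\<lambda>T\<in>dixmier_ideal.
     if positive_op T then complex_of_real (\<omega> (log_mean T))
     else (SOME z. \<exists>A B C D. ideal_decomposition T A B C D \<and>
             z = complex_of_real (\<omega> (log_mean A) - \<omega> (log_mean B))
                   + \<i> * complex_of_real (\<omega> (log_mean C) - \<omega> (log_mean D))))"

definition dixmier_traces :: "(('a::chilbert_space \<Rightarrow>\<^sub>L 'a) \<Rightarrow> complex) set" where
  "dixmier_traces = {Tr \<omega> |\<omega>. generalized_limit \<omega> \<and> dilation_invariant \<omega>}"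

definition exp_dixmier_traces :: "(('a::chilbert_space \<Rightarrow>\<^sub>L 'a) \<Rightarrow> complex) set" where
  "exp_dixmier_traces = {Tr \<omega> |\<omega>. generalized_limit \<omega> \<and> exponentiation_invariant \<omega>}"

definition dixmier_measurable :: "('a::chilbert_space \<Rightarrow>\<^sub>L 'a) \<Rightarrow> bool" where
  "dixmier_measurable T \<longleftrightarrow> T \<in> dixmier_ideal \<and>
     (\<forall>\<phi>\<in>dixmier_traces. \<forall>\<psi>\<in>dixmier_traces. \<phi> T = \<psi> T)"

end

theory Submission
  imports Defs
begin

text \<open>
  Exponentiation acts on the variable \<open>u = log 2 t\<close> by scaling and dilation acts on it by
  translation.  Scaling invariant means do not see a bump that is supported, up to geometrically
  decaying tails, on an interval \<open>[h, C h]\<close> of bounded multiplicative length, if such bumps become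
  multiplicatively sparse: among the scaled points \<open>u, 2 u, 4 u, \<dots>\<close> a long stretch meets the bump
  only boundedly often.  Translation invariant means do see it, because its additive length
  is unbounded.

  The operator is a norm convergent series of multiples of nested coordinate projections.  The
  \<open>n\<close>-th one has rank \<open>2 ^ h\<close> and its multiple has trace \<open>h\<close>, where \<open>h = height n\<close> is
  \<open>(n + 2)!\<close>.  The integral of its singular values over \<open>[0, t]\<close> therefore
  jumps to the order of \<open>h\<close> around \<open>u = h\<close> and stays there until the next height comes
  close, so that the logarithmic mean looks like \<open>h / u\<close> in between: it is bounded
  (\<open>ratio_bounded\<close>), at least \<open>1 / 8\<close> on \<open>[h, h + n]\<close> (\<open>ratio_ge\<close>), and at most \<open>1 / 16\<close> on
  \<open>[128 h, 128 h + n]\<close> for large \<open>n\<close> (\<open>ratio_small\<close>).  Since logarithmic averages over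
  these two families of windows have dilation invariant cluster points
  (\<open>exists_dilation_invariant_limit\<close>), two Dixmier traces differ on the operator.  On the other
  hand, the sums of the mean over \<open>t, t ^ 2, t ^ 4, \<dots>\<close> are bounded regardless of their length for
  large \<open>t\<close> (\<open>ratio_sum_le\<close>), which forces every exponentiation invariant limit
  to vanish on the mean (\<open>exponentiation_invariant_eq_0\<close>).

  Only bounds on the singular values up to constant factors are needed.  The upper one
  (\<open>mu_T_le\<close>) uses coordinate projections as test projections, and the lower one (\<open>mu_T_ge\<close>)
  averages over basis vectors.
\<close>

section \<open>Inner products and orthonormal bases\<close>

lemma cinner_add_left: "cinner (x + y) z = cinner x z + cinner y (z::'h::chilbert_space)"
  by (metis cinner_add_right cinner_commute complex_cnj_add)

lemma cinner_scaleC_left: "cinner (c *\<^sub>C x) y = cnj c * cinner x (y::'h::chilbert_space)"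
  by (metis cinner_commute cinner_scaleC_right complex_cnj_mult)

lemma cinner_zero_right [simp]: "cinner x (0::'h::chilbert_space) = 0"
  using cinner_add_right[of x 0 0] by simp

lemma cinner_zero_left [simp]: "cinner (0::'h::chilbert_space) x = 0"
  using cinner_add_left[of 0 0 x] by simp

lemma cinner_minus_right: "cinner x (- y) = - cinner x (y::'h::chilbert_space)"
  using cinner_add_right[of x y "- y"] by (simp add: eq_neg_iff_add_eq_0 add.commute)

lemma cinner_minus_left: "cinner (- x) y = - cinner x (y::'h::chilbert_space)"
  using cinner_add_left[of x "- x" y] by (simp add: eq_neg_iff_add_eq_0 add.commute)

lemma cinner_diff_right: "cinner x (y - z) = cinner x y - cinner x (z::'h::chilbert_space)"
  using cinner_add_right[of x y "- z"] by (simp add: cinner_minus_right)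

lemma cinner_diff_left: "cinner (x - y) z = cinner x z - cinner y (z::'h::chilbert_space)"
  using cinner_add_left[of x "- y" z] by (simp add: cinner_minus_left)

lemma cinner_scaleR_right: "cinner x (r *\<^sub>R y) = of_real r * cinner x (y::'h::chilbert_space)"
  by (simp add: scaleR_scaleC cinner_scaleC_right)

lemma cinner_sum_right: "cinner x (sum f S) = (\<Sum>i\<in>S. cinner x (f i :: 'h::chilbert_space))"
  by (induction S rule: infinite_finite_induct) (auto simp: cinner_add_right)

lemma norm_add_sq:
  "(norm (x + y))\<^sup>2 = (norm x)\<^sup>2 + 2 * Re (cinner x y) + (norm (y::'h::chilbert_space))\<^sup>2"
proof -
  have "Re (cinner (x + y) (x + y))
      = Re (cinner x x) + Re (cinner x y) + Re (cinner y x) + Re (cinner y y)"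
    by (simp add: cinner_add_left cinner_add_right)
  moreover have "Re (cinner y x) = Re (cinner x y)"
    by (subst cinner_commute) simp
  ultimately show ?thesis
    by (simp add: cinner_self)
qed

lemma norm_scaleC: "norm (c *\<^sub>C x) = cmod c * norm (x::'h::chilbert_space)"
proof -
  have "complex_of_real ((norm (c *\<^sub>C x))\<^sup>2) = cnj c * c * complex_of_real ((norm x)\<^sup>2)"
    unfolding cinner_self[symmetric] by (simp add: cinner_scaleC_left cinner_scaleC_right)
  also have "\<dots> = complex_of_real ((cmod c * norm x)\<^sup>2)"
    by (simp add: power_mult_distrib mult.commute complex_norm_square[unfolded of_real_power])
  finally have "(norm (c *\<^sub>C x))\<^sup>2 = (cmod c * norm x)\<^sup>2"
    using of_real_eq_iff by blast
  then show ?thesis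
    by simp
qed

text \<open>Orthonormal sets; unlike an orthonormal basis they need not span a dense subspace.\<close>

definition orthonormal :: "'h::chilbert_space set \<Rightarrow> bool" where
  "orthonormal S \<longleftrightarrow> (\<forall>e\<in>S. norm e = 1) \<and> (\<forall>e\<in>S. \<forall>f\<in>S. e \<noteq> f \<longrightarrow> cinner e f = 0)"

lemma orthonormal_cinner:
  "orthonormal S \<Longrightarrow> e \<in> S \<Longrightarrow> f \<in> S \<Longrightarrow> cinner e f = (if e = f then 1 else 0)"
  by (auto simp: orthonormal_def cinner_self)

lemma orthonormal_mono: "orthonormal S \<Longrightarrow> S' \<subseteq> S \<Longrightarrow> orthonormal S'"
  by (auto simp: orthonormal_def)

lemma orthonormal_basis_imp_orthonormal: "orthonormal_basis B \<Longrightarrow> orthonormal B"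
  unfolding orthonormal_basis_def orthonormal_def by (elim conjE) (intro conjI)

text \<open>The orthogonal projection onto the span of a finite orthonormal set.\<close>

definition span_proj :: "'h::chilbert_space set \<Rightarrow> 'h \<Rightarrow> 'h" where
  "span_proj S x = (\<Sum>e\<in>S. cinner e x *\<^sub>C e)"

lemma span_proj_add: "span_proj S (x + y) = span_proj S x + span_proj S y"
  by (simp add: span_proj_def cinner_add_right scaleC_add_left sum.distrib)

lemma span_proj_scaleC: "span_proj S (c *\<^sub>C x) = c *\<^sub>C span_proj S x"
  by (simp add: span_proj_def cinner_scaleC_right complex_vector.scale_sum_right scaleC_scaleC)

lemma cinner_span_proj:
  assumes "orthonormal B" "finite S" "S \<subseteq> B" "e \<in> B"
  shows "cinner e (span_proj S x) = (if e \<in> S then cinner e x else 0)"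
proof -
  have "cinner e (span_proj S x) = (\<Sum>f\<in>S. cinner f x * (if e = f then 1 else 0))"
    unfolding span_proj_def cinner_sum_right cinner_scaleC_right
    using assms by (intro sum.cong) (auto simp: orthonormal_cinner)
  also have "\<dots> = (if e \<in> S then cinner e x else 0)"
    using assms by (simp add: if_distrib[of "(*) _"] sum.delta cong: if_cong)
  finally show ?thesis .
qed

lemma span_proj_selfadjoint:
  "cinner (span_proj S x) y = cinner x (span_proj S y)"
proof -
  have "cinner (span_proj S x) y = cnj (\<Sum>e\<in>S. cinner e x * cinner y e)"
    by (subst cinner_commute) (simp add: span_proj_def cinner_sum_right cinner_scaleC_right)
  also have "\<dots> = (\<Sum>e\<in>S. cinner x e * cinner e y)"
    unfolding cnj_sum complex_cnj_mult by (simp add: cinner_commute[symmetric])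
  also have "\<dots> = cinner x (span_proj S y)"
    by (simp add: span_proj_def cinner_sum_right cinner_scaleC_right mult.commute)
  finally show ?thesis .
qed

lemma span_proj_span_proj:
  assumes "orthonormal B" "finite S" "finite S'" "S \<subseteq> B" "S' \<subseteq> B"
  shows "span_proj S (span_proj S' x) = span_proj (S \<inter> S') x"
proof -
  have "span_proj S (span_proj S' x) = (\<Sum>e\<in>S. (if e \<in> S' then cinner e x *\<^sub>C e else 0))"
    unfolding span_proj_def[of S] using assms
    by (intro sum.cong) (auto simp: cinner_span_proj)
  also have "\<dots> = span_proj (S \<inter> S') x"
    unfolding span_proj_def using assms by (simp add: sum.inter_restrict)
  finally show ?thesis .
qed

lemma span_proj_idem:
  "orthonormal S \<Longrightarrow> finite S \<Longrightarrow> span_proj S (span_proj S x) = span_proj S x"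
  using span_proj_span_proj[of S S S x] by simp

text \<open>
  Pythagoras for a self-adjoint idempotent.  It is stated for plain functions so that it serves
  both \<open>span_proj\<close> and bounded projections.
\<close>

lemma norm_selfadjoint_idem:
  fixes p :: "'h::chilbert_space \<Rightarrow> 'h"
  assumes "\<And>x y. cinner (p x) y = cinner x (p y)" and "p (p x) = p x"
  shows "cinner x (p x) = complex_of_real ((norm (p x))\<^sup>2)"
    and "(norm x)\<^sup>2 = (norm (p x))\<^sup>2 + (norm (x - p x))\<^sup>2"
    and "norm (p x) \<le> norm x"
proof -
  show 1: "cinner x (p x) = complex_of_real ((norm (p x))\<^sup>2)"
    using assms by (metis cinner_self)
  have "cinner (p x) (x - p x) = 0"
    using assms by (simp add: cinner_diff_right)
  then show 2: "(norm x)\<^sup>2 = (norm (p x))\<^sup>2 + (norm (x - p x))\<^sup>2"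
    using norm_add_sq[of "p x" "x - p x"] by simp
  show "norm (p x) \<le> norm x"
    by (rule power2_le_imp_le) (use 2 in auto)
qed

lemma norm_span_proj_le:
  "orthonormal S \<Longrightarrow> finite S \<Longrightarrow> norm (span_proj S x) \<le> norm x"
  using norm_selfadjoint_idem(3)[of "span_proj S" x] span_proj_selfadjoint span_proj_idem by blast

lemma bounded_linear_span_proj:
  assumes "orthonormal S" "finite S"
  shows "bounded_linear (span_proj S)"
  by (rule bounded_linear_intro[where K = 1])
    (use assms in \<open>auto simp: span_proj_add scaleR_scaleC span_proj_scaleC norm_span_proj_le\<close>)

lemma cmod_cinner_unit_le:
  fixes e x :: "'h::chilbert_space"
  assumes "norm e = 1"
  shows "cmod (cinner e x) \<le> norm x"
proof -
  have "orthonormal {e}"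
    using assms by (simp add: orthonormal_def)
  from norm_span_proj_le[OF this, of x] show ?thesis
    using assms by (simp add: span_proj_def norm_scaleC)
qed

lemma span_proj_in_cspan: "span_proj S x \<in> cspan S"
  unfolding span_proj_def
  by (intro complex_vector.span_sum complex_vector.span_scale complex_vector.span_base)

lemma span_proj_eq_self:
  assumes "orthonormal S" "finite S" "x \<in> closure (cspan S)"
  shows "span_proj S x = x"
proof -
  have "cspan S \<subseteq> {x. span_proj S x = x}"
  proof
    fix x assume "x \<in> cspan S"
    then show "x \<in> {x. span_proj S x = x}"
    proof (induction rule: complex_vector.span_induct_alt)
      case base
      show ?case
        using span_proj_scaleC[of S 0 0] by simp
    next
      case (step c e y)
      have "span_proj S e = (\<Sum>f\<in>S. if f = e then f else 0)"
        unfolding span_proj_def using assms step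
        by (intro sum.cong) (auto simp: orthonormal_cinner)
      then have "span_proj S e = e"
        using assms step by simp
      then show ?case
        using step by (simp add: span_proj_add span_proj_scaleC)
    qed
  qed
  moreover have "closed {x. span_proj S x = x}"
    using bounded_linear_span_proj[OF assms(1,2)]
    by (intro closed_Collect_eq linear_continuous_on continuous_on_id) auto
  ultimately show ?thesis
    using assms(3) closure_minimal by blast
qed

text \<open>One step of the Gram-Schmidt process.\<close>

lemma orthonormal_extend:
  fixes d :: "'h::chilbert_space"
  assumes "finite S" "orthonormal S"
  obtains S' where "finite S'" "orthonormal S'" "S \<subseteq> S'" "d \<in> cspan S'"
proof (cases "d = span_proj S d")
  case True
  then show ?thesis
    using that[of S] assms span_proj_in_cspan[of S d] by simp
next
  case False
  define r where "r = d - span_proj S d"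
  define e where "e = (1 / norm r) *\<^sub>R r"
  have r: "r \<noteq> 0"
    using False by (simp add: r_def)
  have e: "norm e = 1"
    using r by (simp add: e_def)
  have orth: "cinner f e = 0" if "f \<in> S" for f
    using cinner_span_proj[OF assms(2,1) order_refl that] that
    by (simp add: e_def cinner_scaleR_right r_def cinner_diff_right)
  then have "cinner e f = 0" if "f \<in> S" for f
    using that by (subst cinner_commute) simp
  then have "orthonormal (insert e S)"
    using assms e orth by (auto simp: orthonormal_def)
  moreover have "d \<in> cspan (insert e S)"
  proof -
    have "complex_of_real (norm r) *\<^sub>C e + span_proj S d = d"
      using r by (simp add: scaleR_scaleC[symmetric] e_def r_def)
    moreover have "e \<in> cspan (insert e S)"
      by (rule complex_vector.span_base) simp
    moreover have "span_proj S d \<in> cspan (insert e S)"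
      using span_proj_in_cspan[of S d] complex_vector.span_mono[of S "insert e S"] by blast
    ultimately show ?thesis
      using complex_vector.span_add complex_vector.span_scale by metis
  qed
  ultimately show ?thesis
    using that[of "insert e S"] assms(1) by blast
qed

text \<open>The Gram-Schmidt process, applied to an enumeration of a countable dense set.\<close>

lemma exists_orthonormal_basis:
  assumes "separable_space (euclidean :: 'h::chilbert_space topology)"
  shows "\<exists>B :: 'h set. orthonormal_basis B"
proof -
  obtain D :: "'h set" where D: "countable D" "closure D = UNIV"
    using assms by (auto simp: separable_space_def)
  then have "D \<noteq> {}"
    by auto
  define d where "d = from_nat_into D"
  have ran: "range d = D"
    using D \<open>D \<noteq> {}\<close> by (simp add: d_def)
  have "\<exists>S. \<forall>n. (finite (S n) \<and> orthonormal (S n)) \<and> (S n \<subseteq> S (Suc n) \<and> d n \<in> cspan (S (Suc n)))"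
  proof (rule dependent_nat_choice)
    show "\<exists>x. finite x \<and> orthonormal (x :: 'h set)"
      by (rule exI[of _ "{}"]) (simp add: orthonormal_def)
    show "\<exists>y. (finite y \<and> orthonormal y) \<and> x \<subseteq> y \<and> d n \<in> cspan y"
      if "finite x \<and> orthonormal x" for x n
      using orthonormal_extend[of x "d n"] that by metis
  qed
  then obtain S where S: "\<And>n. orthonormal (S n)" "\<And>n. S n \<subseteq> S (Suc n)"
      "\<And>n. d n \<in> cspan (S (Suc n))"
    by blast
  have mono: "S m \<subseteq> S n" if "m \<le> n" for m n
    using lift_Suc_mono_le[of S, OF S(2) that] .
  have "orthonormal (\<Union>n. S n)"
    unfolding orthonormal_def
  proof (intro conjI ballI impI)
    fix e f assume "e \<in> (\<Union>n. S n)" "f \<in> (\<Union>n. S n)" "e \<noteq> f"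
    then obtain m n where "e \<in> S m" "f \<in> S n"
      by blast
    then have "e \<in> S (max m n)" "f \<in> S (max m n)"
      using mono[of m "max m n"] mono[of n "max m n"] by auto
    then show "cinner e f = 0"
      using S(1)[of "max m n"] \<open>e \<noteq> f\<close> by (simp add: orthonormal_def)
  qed (use S(1) in \<open>auto simp: orthonormal_def\<close>)
  moreover have "D \<subseteq> cspan (\<Union>n. S n)"
  proof -
    have "d n \<in> cspan (\<Union>n. S n)" for n
      using S(3)[of n] complex_vector.span_mono[of "S (Suc n)" "\<Union>n. S n"] by blast
    then show ?thesis
      using ran by blast
  qed
  then have "closure (cspan (\<Union>n. S n)) = UNIV"
    using D(2) closure_mono by blast
  ultimately have "orthonormal_basis (\<Union>n. S n)"
    unfolding orthonormal_basis_def orthonormal_def by blast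
  then show ?thesis ..
qed

text \<open>The span of a finite orthonormal set is closed, hence all of the space if it is dense.\<close>

lemma infinite_orthonormal_basis:
  fixes B :: "'h::chilbert_space set"
  assumes "orthonormal_basis B" and "\<not> (\<exists>B::'h set. finite B \<and> cspan B = UNIV)"
  shows "infinite B"
proof
  assume fin: "finite B"
  have "orthonormal B" "closure (cspan B) = UNIV"
    using assms(1) by (simp_all add: orthonormal_basis_imp_orthonormal orthonormal_basis_def)
  then have "x \<in> cspan B" for x
    using span_proj_eq_self[of B x] span_proj_in_cspan[of B x] fin by simp
  then show False
    using assms(2) fin by blast
qed

lemma norm_cinner_le: "cmod (cinner x y) \<le> norm x * norm (y::'h::chilbert_space)"
proof (cases "x = 0")
  case False
  define e where "e = complex_of_real (1 / norm x) *\<^sub>C x"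
  have e: "norm e = 1"
    using False by (simp add: e_def norm_scaleC norm_divide)
  have "x = complex_of_real (norm x) *\<^sub>C e"
    using False by (simp add: e_def scaleR_scaleC[symmetric])
  then have "cinner x y = complex_of_real (norm x) * cinner e y"
    by (metis cinner_scaleC_left complex_cnj_complex_of_real)
  then show ?thesis
    using cmod_cinner_unit_le[OF e, of y] by (simp add: norm_mult mult_left_mono)
qed simp

lemma bounded_linear_cinner_right: "bounded_linear (cinner (x::'h::chilbert_space))"
  by (rule bounded_linear_intro[where K = "norm x"])
    (auto simp: cinner_add_right cinner_scaleR_right scaleR_conv_of_real
      intro: order_trans[OF norm_cinner_le] simp: mult.commute)

section \<open>Singular values\<close>

lemma pos_trace_zero [simp]: "pos_trace 0 = 0"
  by (simp add: pos_trace_def)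

lemma blinfun_compose_id [simp]: "T o\<^sub>L id_blinfun = T"
  by (rule blinfun_eqI) simp

lemma projection_op_id: "projection_op id_blinfun"
  by (auto simp: projection_op_def BH_def intro: blinfun_eqI)

lemma projection_op_norm_le:
  assumes "projection_op p"
  shows "norm (p x) \<le> norm x"
    and "cinner x (p x) = complex_of_real ((norm (p x))\<^sup>2)"
proof -
  have "p (p x) = p x"
    using assms by (metis projection_op_def blinfun_apply_blinfun_compose)
  then show "norm (p x) \<le> norm x" "cinner x (p x) = complex_of_real ((norm (p x))\<^sup>2)"
    using norm_selfadjoint_idem[of p x] assms by (auto simp: projection_op_def)
qed

lemma norm_projection_op: "projection_op p \<Longrightarrow> norm p \<le> 1"
  by (rule norm_blinfun_bound) (simp_all add: projection_op_norm_le)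

lemma projection_op_compl:
  assumes "projection_op p"
  shows "projection_op (id_blinfun - p)"
proof -
  have p: "p (p x) = p x" for x
    using assms by (metis projection_op_def blinfun_apply_blinfun_compose)
  show ?thesis
    unfolding projection_op_def
  proof (intro conjI allI)
    show "id_blinfun - p \<in> BH"
      using assms by (auto simp: projection_op_def BH_def blinfun.diff_left
          complex_vector.scale_right_diff_distrib)
    show "(id_blinfun - p) o\<^sub>L (id_blinfun - p) = id_blinfun - p"
      by (rule blinfun_eqI) (simp add: blinfun.diff_left blinfun.diff_right p)
    show "cinner ((id_blinfun - p) x) y = cinner x ((id_blinfun - p) y)" for x y
      using assms by (simp add: projection_op_def blinfun.diff_left cinner_diff_left cinner_diff_right)
  qed
qed

lemma mu_le:
  assumes "projection_op p" "pos_trace (id_blinfun - p) \<le> ennreal t"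
  shows "mu t T \<le> norm (T o\<^sub>L p)"
  unfolding mu_def using assms by (intro cInf_lower bdd_belowI[of _ 0]) auto

lemma mu_ge:
  assumes "\<And>p. projection_op p \<Longrightarrow> pos_trace (id_blinfun - p) \<le> ennreal t \<Longrightarrow> c \<le> norm (T o\<^sub>L p)"
  shows "c \<le> mu t T"
  unfolding mu_def
proof (rule cInf_greatest)
  have "norm (T o\<^sub>L id_blinfun)
      \<in> {norm (T o\<^sub>L p) |p. projection_op p \<and> pos_trace (id_blinfun - p) \<le> ennreal t}"
    using projection_op_id by force
  then show "{norm (T o\<^sub>L p) |p. projection_op p \<and> pos_trace (id_blinfun - p) \<le> ennreal t} \<noteq> {}"
    by blast
qed (use assms in auto)

lemma mu_nonneg: "0 \<le> mu t T"
  by (rule mu_ge) simp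

lemma mu_antimono:
  assumes "s \<le> t"
  shows "mu t T \<le> mu s T"
  by (rule mu_ge) (use assms in \<open>auto intro!: mu_le intro: order_trans ennreal_leI\<close>)

lemma mu_le_norm: "mu t T \<le> norm T"
  using mu_le[OF projection_op_id, of t T] by simp

lemma borel_measurable_mu: "(\<lambda>s. mu s T) \<in> borel_measurable borel"
proof -
  have "mono (\<lambda>s. - mu s T)"
    by (auto intro!: monoI mu_antimono)
  then have "(\<lambda>s. - mu s T) \<in> borel_measurable borel"
    by (rule borel_measurable_mono)
  then show ?thesis
    by simp
qed

lemma set_integrable_mu: "set_integrable lborel {0..t} (\<lambda>s. mu s T)"
proof (rule set_integrable_bound)
  show "set_integrable lborel {0..t} (\<lambda>s. norm T)"
    unfolding set_integrable_def
    by (intro integrable_real_mult_indicator integrable_indicator) (simp_all add: emeasure_lborel_Icc_eq)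
  show "set_borel_measurable lborel {0..t} (\<lambda>s. mu s T)"
    using borel_measurable_mu[of T] unfolding set_borel_measurable_def by simp
qed (auto simp: mu_nonneg mu_le_norm)

text \<open>The numerator of the logarithmic mean, i.e. the integral of \<open>\<mu>(s, T)\<close> over \<open>[0, t]\<close>.\<close>

definition mu_int :: "('h::chilbert_space \<Rightarrow>\<^sub>L 'h) \<Rightarrow> real \<Rightarrow> real" where
  "mu_int T t = (LBINT s:{0..t}. mu s T)"

lemma log_mean_eq: "log_mean T t = mu_int T t / ln (1 + t)"
  by (simp add: log_mean_def mu_int_def)

lemma mono_mu_int: "mono (mu_int T)"
proof (rule monoI)
  fix s t :: real assume "s \<le> t"
  then have "indicator {0..s} u *\<^sub>R mu u T \<le> indicator {0..t} u *\<^sub>R mu u T" for u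
    by (auto simp: indicator_def mu_nonneg)
  then show "mu_int T s \<le> mu_int T t"
    unfolding mu_int_def set_lebesgue_integral_def
    using set_integrable_mu[of _ T] unfolding set_integrable_def by (intro integral_mono) auto
qed

lemma mu_int_nonneg: "0 \<le> mu_int T t"
  unfolding mu_int_def set_lebesgue_integral_def
  by (intro Bochner_Integration.integral_nonneg) (simp add: mu_nonneg)

lemma borel_measurable_log_mean: "log_mean T \<in> borel_measurable borel"
proof -
  have [measurable]: "mu_int T \<in> borel_measurable borel"
    using mono_mu_int by (rule borel_measurable_mono)
  have "(\<lambda>t. mu_int T t / ln (1 + t)) \<in> borel_measurable borel"
    by measurable
  then show ?thesis
    by (simp add: log_mean_eq[abs_def])
qed

section \<open>Weighted sums of nested coordinate projections\<close>

text \<open>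
  The locale fixes a sequence of distinct vectors of the very orthonormal basis that the trace is
  computed in.  Traces of the projections below can then be read off without knowing that the
  trace does not depend on the basis.
\<close>

locale trace_basis =
  fixes f :: "nat \<Rightarrow> 'h::chilbert_space"
  assumes basis: "orthonormal_basis (SOME B :: 'h set. orthonormal_basis B)"
    and inj_f: "inj f"
    and range_f: "range f \<subseteq> (SOME B. orthonormal_basis B)"
begin

abbreviation "B0 \<equiv> (SOME B :: 'h set. orthonormal_basis B)"

lemma orthonormal_B0: "orthonormal B0"
  using basis by (rule orthonormal_basis_imp_orthonormal)

lemma f_in: "f k \<in> B0"
  by (rule subsetD[OF range_f rangeI])

lemma norm_f [simp]: "norm (f k) = 1"
  using orthonormal_B0 f_in by (auto simp: orthonormal_def)

lemma initial: "finite (f ` {..<n})" "f ` {..<n} \<subseteq> B0" "orthonormal (f ` {..<n})"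
proof -
  show "f ` {..<n} \<subseteq> B0"
    by (intro image_subsetI f_in)
  then show "orthonormal (f ` {..<n})"
    by (rule orthonormal_mono[OF orthonormal_B0])
qed simp

text \<open>The projection onto the span of the first \<open>n\<close> vectors of the sequence.\<close>

definition P :: "nat \<Rightarrow> 'h \<Rightarrow>\<^sub>L 'h" where
  "P n = Blinfun (span_proj (f ` {..<n}))"

lemma P_apply: "blinfun_apply (P n) = span_proj (f ` {..<n})"
  unfolding P_def by (intro bounded_linear_Blinfun_apply bounded_linear_span_proj initial)

lemma P_compose: "P m o\<^sub>L P n = P (min m n)"
proof (rule blinfun_eqI)
  fix x
  have "f ` {..<m} \<inter> f ` {..<n} = f ` {..<min m n}"
    using inj_f by (auto simp: inj_eq)
  then show "(P m o\<^sub>L P n) x = P (min m n) x"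
    by (simp add: P_apply span_proj_span_proj[OF orthonormal_B0] initial)
qed

lemma projection_op_P: "projection_op (P n)"
  unfolding projection_op_def using P_compose[of n n]
  by (auto simp: BH_def P_apply span_proj_scaleC span_proj_selfadjoint)

lemma cinner_f_P: "cinner (f k) (P n x) = (if k < n then cinner (f k) x else 0)"
proof -
  have "f k \<in> f ` {..<n} \<longleftrightarrow> k < n"
    using inj_f by (auto simp: inj_eq)
  then show ?thesis
    by (simp add: P_apply cinner_span_proj[OF orthonormal_B0 _ _ f_in] initial)
qed

lemma pos_trace_P: "pos_trace (P n) = ennreal (real n)"
proof -
  have "pos_trace (P n) = (\<Sum>\<^sub>\<infinity>e\<in>f ` {..<n}. (1::ennreal))"
    unfolding pos_trace_def
  proof (rule infsum_cong_neutral)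
    show "ennreal (Re (cinner e (P n e))) = 0" if "e \<in> B0 - f ` {..<n}" for e
      using that by (simp add: P_apply cinner_span_proj[OF orthonormal_B0] initial)
    show "ennreal (Re (cinner e (P n e))) = 1" if "e \<in> B0 \<inter> f ` {..<n}" for e
      using that orthonormal_cinner[OF orthonormal_B0, of e e]
      by (simp add: P_apply cinner_span_proj[OF orthonormal_B0] initial)
  qed (use initial in auto)
  also have "\<dots> = of_nat (card (f ` {..<n}))"
    by (simp add: initial)
  also have "card (f ` {..<n}) = n"
    using inj_f by (simp add: card_image inj_on_subset)
  finally show ?thesis
    by (simp add: ennreal_of_nat_eq_real_of_nat)
qed

end

text \<open>
  A series of multiples \<open>c n\<close> of such projections of rank \<open>N n\<close>, which converges in operator
  norm.
\<close>

locale projection_series = trace_basis f for f :: "nat \<Rightarrow> 'h::chilbert_space" +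
  fixes c :: "nat \<Rightarrow> real" and N :: "nat \<Rightarrow> nat"
  assumes c_nonneg: "0 \<le> c n" and summable_c: "summable c"
begin

text \<open>
  This is the diagonal operator whose \<open>k\<close>-th eigenvalue is the sum of all \<open>c n\<close> with
  \<open>k < N n\<close>.
\<close>

definition T :: "'h \<Rightarrow>\<^sub>L 'h" where
  "T = (\<Sum>n. c n *\<^sub>R P (N n))"

lemma sums_T: "(\<lambda>n. c n *\<^sub>R P (N n)) sums T"
  unfolding T_def
proof (rule summable_sums, rule summable_comparison_test'[OF summable_c])
  show "norm (c n *\<^sub>R P (N n)) \<le> c n" for n
    using c_nonneg[of n] norm_projection_op[OF projection_op_P] by (simp add: mult_left_le)
qed

lemma sums_T_apply: "(\<lambda>n. c n *\<^sub>R P (N n) x) sums T x"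
  using bounded_linear.sums[OF blinfun.bounded_linear_left sums_T] by (simp add: blinfun.scaleR_left)

lemma sums_cinner_T: "(\<lambda>n. of_real (c n) * cinner y (P (N n) x)) sums cinner y (T x)"
  using bounded_linear.sums[OF bounded_linear_cinner_right sums_T_apply, of y x]
  by (simp add: cinner_scaleR_right)

lemma T_BH: "T \<in> BH"
  unfolding BH_def
proof (intro CollectI allI)
  fix a x
  have "bounded_linear (\<lambda>y::'h. a *\<^sub>C y)"
    by (rule bounded_linear_intro[where K = "cmod a"])
      (simp_all add: scaleC_add_right scaleR_scaleC scaleC_scaleC mult.commute norm_scaleC)
  from bounded_linear.sums[OF this sums_T_apply[of x]]
  have "(\<lambda>n. c n *\<^sub>R P (N n) (a *\<^sub>C x)) sums (a *\<^sub>C T x)"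
    by (simp add: P_apply span_proj_scaleC scaleR_scaleC scaleC_scaleC mult.commute)
  then show "T (a *\<^sub>C x) = a *\<^sub>C T x"
    using sums_T_apply sums_unique2 by blast
qed

lemma positive_T: "positive_op T"
  unfolding positive_op_def
proof (intro conjI allI T_BH)
  fix x
  have "(\<lambda>n. complex_of_real (c n * (norm (P (N n) x))\<^sup>2)) sums cinner x (T x)"
    using sums_cinner_T[of x x] by (simp add: projection_op_norm_le(2)[OF projection_op_P])
  then have "(\<lambda>n. c n * (norm (P (N n) x))\<^sup>2) sums Re (cinner x (T x))"
    and "(\<lambda>n. 0) sums Im (cinner x (T x))"
    unfolding sums_complex_iff by simp_all
  then have "0 \<le> Re (cinner x (T x))" "Im (cinner x (T x)) = 0"
    using sums_le[OF _ sums_zero, of "\<lambda>n. c n * (norm (P (N n) x))\<^sup>2"] sums_unique2[OF _ sums_zero] c_nonneg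
    by auto
  then show "cinner x (T x) \<in> \<real>\<^sub>\<ge>\<^sub>0"
    by (simp add: complex_nonneg_Reals_iff)
qed

lemma summable_c_of_bool: "summable (\<lambda>n. c n * of_bool (Q n))"
  by (rule summable_comparison_test'[OF summable_c]) (simp add: c_nonneg)

text \<open>The projection away from the first \<open>\<lfloor>s\<rfloor>\<close> vectors kills all terms of rank at most \<open>s\<close>.\<close>

lemma mu_T_le:
  assumes "0 \<le> s"
  shows "mu s T \<le> (\<Sum>n. c n * of_bool (s < N n))"
proof -
  define d where "d = nat \<lfloor>s\<rfloor>"
  define p where "p = id_blinfun - P d"
  have d: "real d \<le> s" "s < real (N n) \<longleftrightarrow> d < N n" for n
    using assms by (auto simp: d_def) linarith+
  have p: "projection_op p"
    unfolding p_def by (rule projection_op_compl[OF projection_op_P])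
  have "mu s T \<le> norm (T o\<^sub>L p)"
    using p d(1) by (intro mu_le) (simp_all add: p_def pos_trace_P ennreal_leI)
  also have "(\<lambda>n. (c n *\<^sub>R P (N n)) o\<^sub>L p) sums (T o\<^sub>L p)"
    using bounded_linear.sums[OF bounded_bilinear.bounded_linear_left[OF
          bounded_bilinear_blinfun_compose] sums_T] .
  then have "T o\<^sub>L p = (\<Sum>n. (c n *\<^sub>R P (N n)) o\<^sub>L p)"
    by (rule sums_unique)
  also have "norm \<dots> \<le> (\<Sum>n. c n * of_bool (s < N n))"
  proof (rule norm_suminf_le[OF _ summable_c_of_bool])
    fix n
    show "norm ((c n *\<^sub>R P (N n)) o\<^sub>L p) \<le> c n * of_bool (s < N n)"
    proof (cases "s < N n")
      case True
      have "norm ((c n *\<^sub>R P (N n)) o\<^sub>L p) \<le> norm (c n *\<^sub>R P (N n)) * norm p"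
        by (rule norm_blinfun_compose)
      also have "\<dots> \<le> c n * 1"
        using c_nonneg[of n] norm_projection_op[OF projection_op_P, of "N n"] norm_projection_op[OF p]
        by (intro mult_mono) (simp_all add: mult_left_le)
      finally show ?thesis
        using True by simp
    next
      case False
      then have "min (N n) d = N n"
        using d(2) by auto
      then have "P (N n) o\<^sub>L p = 0"
        using P_compose[of "N n" d]
        by (simp add: p_def bounded_bilinear.diff_right[OF bounded_bilinear_blinfun_compose])
      then show ?thesis
        using False by (simp add: bounded_bilinear.scaleR_left[OF bounded_bilinear_blinfun_compose])
    qed
  qed
  finally show ?thesis .
qed

text \<open>
  This is half of the natural bound and holds on half of the natural range, which spares an
  argument about dimensions: if \<open>1 - p\<close> has trace at most \<open>N m / 2\<close>, then by averaging over the
  first \<open>N m\<close> vectors, \<open>p\<close> keeps at least half of the squared norm of one of them.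
\<close>

lemma mu_T_ge:
  assumes "0 \<le> s" "s \<le> real (N m) / 2" "0 < N m"
  shows "c m / 2 \<le> mu s T"
proof (rule mu_ge)
  fix p :: "'h \<Rightarrow>\<^sub>L 'h"
  assume p: "projection_op p" and tr: "pos_trace (id_blinfun - p) \<le> ennreal s"
  have diag: "Re (cinner e ((id_blinfun - p) e)) = 1 - (norm (p e))\<^sup>2" if "norm e = 1" for e
    using that by (simp add: blinfun.diff_left cinner_diff_right cinner_self projection_op_norm_le[OF p])
  have nonneg: "0 \<le> 1 - (norm (p (f k)))\<^sup>2" for k
    using projection_op_norm_le(1)[OF p, of "f k"] by (simp add: power_le_one)
  have "ennreal (\<Sum>k<N m. 1 - (norm (p (f k)))\<^sup>2) = (\<Sum>k<N m. ennreal (1 - (norm (p (f k)))\<^sup>2))"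
    using nonneg by (simp add: sum_ennreal)
  also have "\<dots> = (\<Sum>e\<in>f ` {..<N m}. ennreal (Re (cinner e ((id_blinfun - p) e))))"
    using inj_f by (subst sum.reindex) (auto simp: diag intro: inj_on_subset)
  also have "\<dots> \<le> pos_trace (id_blinfun - p)"
  proof -
    have "(\<Sum>\<^sub>\<infinity>e\<in>f ` {..<N m}. ennreal (Re (cinner e ((id_blinfun - p) e))))
        \<le> (\<Sum>\<^sub>\<infinity>e\<in>B0. ennreal (Re (cinner e ((id_blinfun - p) e))))"
      using initial by (intro infsum_mono_neutral nonneg_summable_on_complete) auto
    then show ?thesis
      by (simp add: pos_trace_def initial)
  qed
  also have "\<dots> \<le> ennreal s"
    by (rule tr)
  finally have sum_le: "(\<Sum>k<N m. 1 - (norm (p (f k)))\<^sup>2) \<le> s"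
    using assms(1) by (simp add: ennreal_le_iff)
  have "\<exists>k<N m. 1 - (norm (p (f k)))\<^sup>2 \<le> 1 / 2"
  proof (rule ccontr)
    assume "\<not> ?thesis"
    then have "(\<Sum>k<N m. 1 / 2) < (\<Sum>k<N m. 1 - (norm (p (f k)))\<^sup>2)"
      using assms(3) by (intro sum_strict_mono) auto
    then show False
      using sum_le assms(2) by simp
  qed
  then obtain k where k: "k < N m" "1 / 2 \<le> (norm (p (f k)))\<^sup>2"
    by auto
  have "(\<lambda>n. complex_of_real (c n * (if k < N n then (norm (p (f k)))\<^sup>2 else 0)))
      sums cinner (f k) (T (p (f k)))"
    using sums_cinner_T[of "f k" "p (f k)"]
    by (simp add: cinner_f_P projection_op_norm_le(2)[OF p] if_distrib cong: if_cong)
  then have *: "(\<lambda>n. c n * (if k < N n then (norm (p (f k)))\<^sup>2 else 0)) sums Re (cinner (f k) (T (p (f k))))"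
    unfolding sums_complex_iff by simp
  have "(\<Sum>n\<in>{m}. c n * (if k < N n then (norm (p (f k)))\<^sup>2 else 0)) \<le> Re (cinner (f k) (T (p (f k))))"
    unfolding sums_unique[OF *] using c_nonneg
    by (intro sum_le_suminf sums_summable[OF *]) auto
  then have "c m * (norm (p (f k)))\<^sup>2 \<le> Re (cinner (f k) (T (p (f k))))"
    using k(1) by simp
  moreover have "c m * (1 / 2) \<le> c m * (norm (p (f k)))\<^sup>2"
    using k(2) c_nonneg by (rule mult_left_mono)
  ultimately have "c m / 2 \<le> Re (cinner (f k) (T (p (f k))))"
    by simp
  also have "\<dots> \<le> cmod (cinner (f k) (T (p (f k))))"
    by (rule complex_Re_le_cmod)
  also have "\<dots> \<le> norm (T (p (f k)))"
    by (rule cmod_cinner_unit_le) simp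
  also have "\<dots> \<le> norm (T o\<^sub>L p)"
    using norm_blinfun[of "T o\<^sub>L p" "f k"] by simp
  finally show "c m / 2 \<le> norm (T o\<^sub>L p)" .
qed

text \<open>
  Each of the first \<open>K\<close> terms of the series contributes at most its trace, and the remaining
  ones at most their norm times the length of the interval.
\<close>

lemma mu_int_T_le:
  assumes "0 \<le> t"
  shows "mu_int T t \<le> (\<Sum>n<K. c n * N n) + t * (\<Sum>n. c (n + K))"
proof -
  define r where "r = (\<Sum>n. c (n + K))"
  have bound: "mu s T \<le> (\<Sum>n<K. c n * indicator {..<real (N n)} s) + r" if "0 \<le> s" for s
  proof -
    have "mu s T \<le> (\<Sum>n. c n * of_bool (s < N n))"
      by (rule mu_T_le[OF that])
    also have "\<dots> = (\<Sum>n. c (n + K) * of_bool (s < N (n + K))) + (\<Sum>n<K. c n * of_bool (s < N n))"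
      by (rule suminf_split_initial_segment[OF summable_c_of_bool])
    also have "(\<Sum>n. c (n + K) * of_bool (s < N (n + K))) \<le> r"
      unfolding r_def
    proof (rule suminf_le)
      show "summable (\<lambda>n. c (n + K) * of_bool (s < N (n + K)))"
        using summable_ignore_initial_segment[OF summable_c_of_bool[of "\<lambda>n. s < N n"], of K] .
      show "summable (\<lambda>n. c (n + K))"
        using summable_ignore_initial_segment[OF summable_c] .
    qed (simp add: c_nonneg)
    finally show ?thesis
      by (simp add: indicator_def of_bool_def add.commute)
  qed
  have int: "integrable lborel (\<lambda>s. indicator {0..t} s * (c n * indicator {..<real (N n)} s))"
    and le: "(\<integral>s. indicator {0..t} s * (c n * indicator {..<real (N n)} s) \<partial>lborel) \<le> c n * N n" for n
  proof -
    have eq: "(\<lambda>s. indicator {0..t} s * (c n * indicator {..<real (N n)} s) :: real)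
        = (\<lambda>s. c n * indicator ({0..t} \<inter> {..<real (N n)}) s)"
      by (auto simp: indicator_def)
    have sub: "{0..t} \<inter> {..<real (N n)} \<subseteq> {0..real (N n)}"
      by auto
    have fin: "emeasure lborel ({0..t} \<inter> {..<real (N n)}) < \<infinity>"
      by (rule le_less_trans[OF emeasure_mono[OF sub]]) simp_all
    then show "integrable lborel (\<lambda>s. indicator {0..t} s * (c n * indicator {..<real (N n)} s))"
      unfolding eq by simp
    have "measure lborel ({0..t} \<inter> {..<real (N n)}) \<le> measure lborel {0..real (N n)}"
      by (rule measure_mono_fmeasurable[OF sub]) (auto simp: fmeasurable_def)
    then show "(\<integral>s. indicator {0..t} s * (c n * indicator {..<real (N n)} s) \<partial>lborel) \<le> c n * N n"
      unfolding eq using c_nonneg by (simp add: mult_left_mono)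
  qed
  have int_r: "integrable lborel (\<lambda>s. indicator {0..t} s * r)"
    by (intro integrable_mult_left integrable_real_indicator) (simp_all add: emeasure_lborel_Icc_eq)
  have "mu_int T t = (\<integral>s. indicator {0..t} s * mu s T \<partial>lborel)"
    by (simp add: mu_int_def set_lebesgue_integral_def)
  also have "\<dots> \<le> (\<integral>s. (\<Sum>n<K. indicator {0..t} s * (c n * indicator {..<real (N n)} s))
      + indicator {0..t} s * r \<partial>lborel)"
  proof (rule integral_mono)
    show "integrable lborel (\<lambda>s. indicator {0..t} s * mu s T)"
      using set_integrable_mu[of t T] by (simp add: set_integrable_def)
    show "integrable lborel (\<lambda>s. (\<Sum>n<K. indicator {0..t} s * (c n * indicator {..<real (N n)} s))
        + indicator {0..t} s * r)"
      using int int_r by (intro Bochner_Integration.integrable_add Bochner_Integration.integrable_sum) auto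
    show "indicator {0..t} s * mu s T
        \<le> (\<Sum>n<K. indicator {0..t} s * (c n * indicator {..<real (N n)} s)) + indicator {0..t} s * r" for s
      using bound[of s] by (cases "s \<in> {0..t}") simp_all
  qed
  also have "\<dots> = (\<Sum>n<K. \<integral>s. indicator {0..t} s * (c n * indicator {..<real (N n)} s) \<partial>lborel)
      + (\<integral>s. indicator {0..t} s * r \<partial>lborel)"
    by (subst Bochner_Integration.integral_add[OF Bochner_Integration.integrable_sum[OF int] int_r],
        subst Bochner_Integration.integral_sum[OF int]) (rule refl)
  also have "\<dots> \<le> (\<Sum>n<K. c n * N n) + t * r"
    using assms by (intro add_mono sum_mono le) simp
  finally show ?thesis
    by (simp add: r_def)
qed

lemma mu_int_T_ge:
  assumes "0 < N m" "real (N m) / 2 \<le> t"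
  shows "c m * N m / 4 \<le> mu_int T t"
proof -
  have "c m * N m / 4 = (\<integral>s. indicator {0..real (N m) / 2} s * (c m / 2) \<partial>lborel)"
    by simp
  also have "\<dots> \<le> (\<integral>s. indicator {0..real (N m) / 2} s * mu s T \<partial>lborel)"
  proof (rule integral_mono)
    show "integrable lborel (\<lambda>s. indicator {0..real (N m) / 2} s * mu s T)"
      using set_integrable_mu[of _ T] by (simp add: set_integrable_def)
    show "indicator {0..real (N m) / 2} s * (c m / 2) \<le> indicator {0..real (N m) / 2} s * mu s T" for s
      using mu_T_ge[of s m] assms(1) by (cases "s \<in> {0..real (N m) / 2}") simp_all
  qed simp
  also have "\<dots> = mu_int T (real (N m) / 2)"
    by (simp add: mu_int_def set_lebesgue_integral_def)
  also have "\<dots> \<le> mu_int T t"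
    using mono_mu_int assms(2) by (rule monoD)
  finally show ?thesis .
qed

end

section \<open>The growth of the partial integrals\<close>

text \<open>
  The ranks of the projections will be \<open>2 ^ height n\<close> and the weights are such that the
  \<open>n\<close>-th term of the series has trace \<open>height n\<close>.  What matters about the factorials is that
  the quotients of consecutive heights tend to infinity.
\<close>

definition height :: "nat \<Rightarrow> nat" where
  "height n = fact (n + 2)"

definition weight :: "nat \<Rightarrow> real" where
  "weight n = height n / 2 ^ height n"

lemma height_Suc: "height (Suc n) = (n + 3) * height n"
proof -
  have "height (Suc n) = fact (Suc (n + 2))"
    by (simp only: height_def add_Suc)
  also have "\<dots> = Suc (n + 2) * height n"
    by (simp only: height_def fact_Suc of_nat_id)
  finally show ?thesis
    by (simp add: algebra_simps)
qed

lemma height_ge: "n + 2 \<le> height n"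
  unfolding height_def by (rule fact_ge_self)

lemma sum_height_le: "(\<Sum>n<K. height n) \<le> height K"
proof (induction K)
  case (Suc K)
  then have "(\<Sum>n<Suc K. height n) \<le> 2 * height K"
    by simp
  also have "\<dots> \<le> height (Suc K)"
    unfolding height_Suc by (intro mult_right_mono) auto
  finally show ?case .
qed simp

lemma weight_nonneg: "0 \<le> weight n"
  by (simp add: weight_def)

lemma weight_Suc_le: "weight (Suc n) \<le> weight n / 2"
proof -
  define a where "a = height n"
  define d where "d = (n + 2) * height n"
  have a: "2 \<le> a"
    using height_ge[of n] by (simp add: a_def)
  have d: "2 \<le> d"
    using a mult_le_mono[of 1 "n + 2" 2 "height n"] by (simp add: a_def d_def)
  have ad: "height (Suc n) = a + d"
    by (simp add: height_Suc a_def d_def algebra_simps)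
  have pow: "d + 2 \<le> 2 ^ d"
    using d by (induction d rule: dec_induct) auto
  have "2 * (a + d) \<le> 2 * a + a * d"
    using a by simp
  also have "\<dots> = a * (d + 2)"
    by (simp add: algebra_simps)
  also have "\<dots> \<le> a * 2 ^ d"
    using pow by (rule mult_left_mono) simp
  finally have "real (2 * (a + d)) \<le> real (a * 2 ^ d)"
    by (simp only: of_nat_le_iff)
  then have "2 * (real a + real d) \<le> real a * 2 ^ d"
    by simp
  from mult_right_mono[OF this, of "2 ^ a"] show ?thesis
    by (simp add: weight_def ad power_add field_simps flip: a_def)
qed

lemma weight_add_le: "weight (n + K) \<le> weight K * (1 / 2) ^ n"
proof (induction n)
  case (Suc n)
  then show ?case
    using weight_Suc_le[of "n + K"] by simp
qed simp

lemma summable_weight: "summable weight"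
proof (rule summable_comparison_test')
  show "summable (\<lambda>n. weight 0 * (1 / 2) ^ n)"
    by (intro summable_mult summable_geometric) simp
  show "norm (weight n) \<le> weight 0 * (1 / 2) ^ n" for n
    using weight_add_le[of n 0] weight_nonneg[of n] by simp
qed

lemma weight_tail_le: "(\<Sum>n. weight (n + K)) \<le> 2 * weight K"
proof -
  have "(\<Sum>n. weight (n + K)) \<le> (\<Sum>n. weight K * (1 / 2) ^ n)"
    by (intro suminf_le weight_add_le summable_ignore_initial_segment summable_weight
        summable_mult summable_geometric) simp
  also have "\<dots> = 2 * weight K"
    using suminf_geometric[of "1 / 2 :: real"] by (simp add: suminf_mult summable_geometric)
  finally show ?thesis .
qed

text \<open>With the least \<open>K\<close> that satisfies the first inequality, the second one holds too.\<close>

lemma exists_level: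
  fixes u :: real
  assumes "0 \<le> u"
  shows "\<exists>K. 2 * u \<le> height K \<and> real (\<Sum>n<K. height n) \<le> 4 * u"
proof -
  define K where "K = (LEAST K. 2 * u \<le> height K)"
  obtain n :: nat where "2 * u \<le> n"
    using real_arch_simple by blast
  then have "2 * u \<le> height n"
    using height_ge[of n] by linarith
  then have K: "2 * u \<le> height K"
    unfolding K_def by (rule LeastI)
  moreover have "real (\<Sum>n<K. height n) \<le> 4 * u"
  proof (cases K)
    case (Suc k)
    then have "\<not> 2 * u \<le> height k"
      using not_less_Least[of k "\<lambda>K. 2 * u \<le> height K"] by (simp add: K_def)
    moreover have "(\<Sum>n<K. height n) \<le> 2 * height k"
      using sum_height_le[of k] Suc by simp
    ultimately show ?thesis
      by linarith
  qed (use assms in simp)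
  ultimately show ?thesis
    by blast
qed

text \<open>
  The total is less than 2, being dominated by a geometric series whose first term is below 1.
  The right-hand side is the form of the bound that an induction can carry.
\<close>

lemma sum_geometric_tail_le:
  fixes y :: real
  assumes "0 < y"
  shows "(\<Sum>j<M. if y < 2 ^ j then y / 2 ^ j else 0) \<le> max 0 (2 - 2 * y / 2 ^ M)"
proof (induction M)
  case (Suc M)
  show ?case
  proof (cases "y < 2 ^ M")
    case True
    then have "2 * y / 2 ^ M \<le> 2"
      by (simp add: field_simps)
    then have "(\<Sum>j<M. if y < 2 ^ j then y / 2 ^ j else 0) \<le> 2 - 2 * y / 2 ^ M"
      using Suc by (simp add: max_def)
    then have "(\<Sum>j<Suc M. if y < 2 ^ j then y / 2 ^ j else 0) \<le> 2 - 2 * y / 2 ^ M + y / 2 ^ M"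
      using True by simp
    also have "\<dots> = 2 - 2 * y / 2 ^ Suc M"
      by simp
    finally show ?thesis
      by simp
  next
    case False
    then have "2 - 2 * y / 2 ^ M \<le> 0"
      by (simp add: field_simps)
    then show ?thesis
      using Suc False by simp
  qed
qed simp

lemma le_two_powr:
  fixes x :: real
  assumes "0 \<le> x"
  shows "x \<le> 2 powr x"
proof -
  have "1 + x / 3 \<le> 1 + x / 2 * ln 2"
    using assms ln2_ge_two_thirds mult_left_mono[of "2 / 3" "ln 2" "x / 2"] by simp
  also have "\<dots> \<le> 2 powr (x / 2)"
    using exp_ge_add_one_self[of "x / 2 * ln 2"] by (simp add: powr_def)
  finally have "(1 + x / 3)\<^sup>2 \<le> (2 powr (x / 2))\<^sup>2"
    using assms by (intro power_mono) auto
  also have "\<dots> = 2 powr x"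
    by (simp add: power2_eq_square powr_add[symmetric])
  finally have "(1 + x / 3)\<^sup>2 \<le> 2 powr x" .
  moreover have "x \<le> (1 + x / 3)\<^sup>2"
    using zero_le_power2[of "x / 3 - 1 / 2"] by (simp add: power2_eq_square algebra_simps)
  ultimately show ?thesis
    by linarith
qed

text \<open>
  All further estimates use only these two bounds on the function \<open>L\<close>, which the integrated
  singular values will satisfy: in the variable \<open>u = log 2 t\<close>, it rises to about \<open>height m\<close>
  near \<open>u = height m\<close> and is nearly constant in between.
\<close>

locale staircase =
  fixes L :: "real \<Rightarrow> real"
  assumes upper: "0 \<le> t \<Longrightarrow> L t \<le> real (\<Sum>n<K. height n) + t * (\<Sum>n. weight (n + K))"
    and lower: "2 ^ height m / 2 \<le> t \<Longrightarrow> height m / 4 \<le> L t"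
begin

lemma ratio_le:
  fixes u :: real
  assumes u: "1 \<le> u" "2 * u \<le> height K"
  shows "L (2 powr u) / ln (1 + 2 powr u) \<le> 2 * (real (\<Sum>n<K. height n) + 4) / u"
proof -
  define h where "h = real (height K)"
  have "2 powr u * (\<Sum>n. weight (n + K)) \<le> 2 powr (h / 2) * (2 * weight K)"
    using u weight_tail_le[of K] weight_nonneg
    by (intro mult_mono suminf_nonneg summable_ignore_initial_segment summable_weight powr_mono)
      (auto simp: h_def)
  also have "\<dots> = 2 * h * (2 powr (h / 2) / 2 powr h)"
    by (simp add: weight_def h_def powr_realpow)
  also have "2 powr (h / 2) / 2 powr h = 2 powr - (h / 2)"
    by (simp add: powr_diff[symmetric])
  also have "2 * h * 2 powr - (h / 2) = 4 * ((h / 2) / 2 powr (h / 2))"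
    by (simp add: powr_minus field_simps)
  also have "\<dots> \<le> 4 * 1"
  proof (intro mult_left_mono)
    have "h / 2 \<le> 2 powr (h / 2)"
      by (rule le_two_powr) (simp add: h_def)
    then show "(h / 2) / 2 powr (h / 2) \<le> 1"
      by simp
  qed simp
  finally have "L (2 powr u) \<le> real (\<Sum>n<K. height n) + 4"
    using upper[of "2 powr u" K] by simp
  moreover have "u / 2 \<le> ln (1 + 2 powr u)"
  proof -
    have "u / 2 \<le> u * ln 2"
      using u(1) ln2_ge_two_thirds by simp
    also have "\<dots> = ln (2 powr u)"
      by simp
    also have "\<dots> \<le> ln (1 + 2 powr u)"
      by (rule ln_mono) simp_all
    finally show ?thesis .
  qed
  ultimately have "L (2 powr u) / ln (1 + 2 powr u) \<le> (real (\<Sum>n<K. height n) + 4) / (u / 2)"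
    using u(1) by (intro frac_le) (auto simp del: of_nat_sum)
  then show ?thesis
    by (simp add: mult.commute)
qed

lemma ratio_bounded:
  assumes "0 < t"
  shows "L t / ln (1 + t) \<le> 16"
proof (cases "t \<le> 2")
  case True
  have "weight 0 = 1 / 2"
    by (simp add: weight_def height_def)
  then have "suminf weight \<le> 1"
    using weight_tail_le[of 0] by simp
  have "L t \<le> t * suminf weight"
    using upper[of t 0] assms by simp
  also have "\<dots> \<le> t * 1"
    using assms \<open>suminf weight \<le> 1\<close> by (intro mult_left_mono) auto
  finally have "L t \<le> t"
    by simp
  moreover have "t / 3 \<le> ln (1 + t)"
  proof -
    have "ln (1 / (1 + t)) \<le> 1 / (1 + t) - 1"
      using assms by (intro ln_le_minus_one) simp
    then have "t / (1 + t) \<le> ln (1 + t)"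
      using assms by (simp add: ln_div field_simps)
    moreover have "t / 3 \<le> t / (1 + t)"
      using assms True by (intro divide_left_mono) auto
    ultimately show ?thesis
      by linarith
  qed
  ultimately have "L t / ln (1 + t) \<le> t / (t / 3)"
    using assms by (intro frac_le) auto
  then show ?thesis
    using assms by simp
next
  case False
  define u where "u = log 2 t"
  have u: "1 \<le> u" "t = 2 powr u"
    using False by (auto simp: u_def le_log_iff)
  obtain K where K: "2 * u \<le> height K" "real (\<Sum>n<K. height n) \<le> 4 * u"
    using exists_level[of u] u by auto
  have "L t / ln (1 + t) \<le> 2 * (real (\<Sum>n<K. height n) + 4) / u"
    using ratio_le[OF u(1) K(1)] u(2) by simp
  also have "\<dots> \<le> 2 * (4 * u + 4) / u"
    using u K(2) by (intro divide_right_mono) auto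
  also have "\<dots> \<le> 16"
    using u by (simp add: field_simps)
  finally show ?thesis .
qed

text \<open>
  The bound does not depend on \<open>M\<close>.  For large \<open>t\<close>, at most one height lies
  strictly between \<open>2 u\<close> and \<open>2 ^ (M + 1) * u\<close>, where \<open>u = log 2 t\<close>.  Below it the summands decay
  geometrically in \<open>j\<close>, and above it they do so again.
\<close>

lemma ratio_sum_le:
  "\<forall>\<^sub>F t in at_top. (\<Sum>j<M. L (t powr 2 ^ j) / ln (1 + t powr 2 ^ j)) \<le> 64"
proof -
  define U where "U = real (height (2 ^ M))"
  have "(\<Sum>j<M. L (t powr 2 ^ j) / ln (1 + t powr 2 ^ j)) \<le> 64" if t: "2 powr U \<le> t" for t
  proof -
    define u where "u = log 2 t"
    have "0 < t"
      by (rule less_le_trans[OF _ t]) simp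
    then have u: "U \<le> u" "t = 2 powr u"
      using t by (auto simp: u_def le_log_iff)
    have "2 \<le> U"
      unfolding U_def using height_ge[of "2 ^ M"] by linarith
    then have u1: "1 \<le> u"
      using u by simp
    obtain K where K: "2 * u \<le> height K" "real (\<Sum>n<K. height n) \<le> 4 * u"
      using exists_level[of u] u1 by auto
    \<comment> \<open>Once \<open>2 ^ M \<le> K\<close>, the height with index \<open>Suc K\<close> is at least \<open>2 ^ (j + 1) * u\<close> for all \<open>j < M\<close>.\<close>
    define h where "h = real (height K)"
    have h2: "2 \<le> h"
      unfolding h_def using height_ge[of K] by linarith
    have "2 ^ M \<le> K"
    proof (rule ccontr)
      assume "\<not> 2 ^ M \<le> K"
      then have "height K \<le> height (2 ^ M)"
        unfolding height_def by (intro fact_mono) simp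
      then show False
        using K(1) u u1 unfolding U_def by linarith
    qed
    define y where "y = h / (2 * u)"
    have y: "0 < y"
      using h2 u1 by (simp add: y_def)
    have bound: "L (t powr 2 ^ j) / ln (1 + t powr 2 ^ j)
        \<le> 16 * (1 / 2) ^ j + 16 * (if y < 2 ^ j then y / 2 ^ j else 0)" if j: "j < M" for j
    proof -
      define v where "v = u * 2 ^ j"
      have v: "1 \<le> v" "t powr 2 ^ j = 2 powr v"
        using u1 mult_mono[of 1 u 1 "2 ^ j"] by (simp_all add: v_def u powr_powr)
      show ?thesis
      proof (cases "y < 2 ^ j")
        case False
        then have "2 * v \<le> h"
          using u1 by (simp add: y_def v_def field_simps)
        then have "L (2 powr v) / ln (1 + 2 powr v) \<le> 2 * (real (\<Sum>n<K. height n) + 4) / v"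
          unfolding h_def by (intro ratio_le v(1))
        also have "\<dots> \<le> 2 * (4 * u + 4 * u) / v"
          using K(2) u1 v(1) by (intro divide_right_mono) auto
        also have "\<dots> = 16 * (1 / 2) ^ j"
          using u1 by (simp add: v_def power_divide)
        finally show ?thesis
          using False v(2) by simp
      next
        case True
        have "2 * v = (2 * u) * 2 ^ j"
          by (simp add: v_def)
        also have "\<dots> \<le> h * 2 ^ M"
          using K(1) j u1 by (intro mult_mono) (auto simp: h_def)
        also have "\<dots> \<le> h * (K + 3)"
        proof (intro mult_left_mono)
          have "2 ^ M \<le> real K"
            using \<open>2 ^ M \<le> K\<close> by (metis of_nat_le_iff of_nat_numeral of_nat_power)
          then show "2 ^ M \<le> real (K + 3)"
            unfolding of_nat_add by linarith
        qed (use h2 in simp)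
        also have "\<dots> = height (Suc K)"
          by (simp add: height_Suc h_def algebra_simps)
        finally have "L (2 powr v) / ln (1 + 2 powr v) \<le> 2 * (real (\<Sum>n<Suc K. height n) + 4) / v"
          by (intro ratio_le v(1))
        also have "\<dots> \<le> 2 * (2 * h + 2 * h) / v"
        proof -
          have "real (\<Sum>n<Suc K. height n) \<le> 2 * h"
            using sum_height_le[of K] unfolding h_def
            by (metis add_mono_thms_linordered_semiring(1) lessThan_Suc mult_2 of_nat_add of_nat_le_iff order_refl sum.lessThan_Suc)
          then show ?thesis
            using h2 v(1) by (intro divide_right_mono) auto
        qed
        also have "\<dots> = 16 * (y / 2 ^ j)"
          by (simp add: y_def v_def)
        finally show ?thesis
          using True v(2) by (simp add: add_increasing)
      qed
    qed
    have "(\<Sum>j<M. L (t powr 2 ^ j) / ln (1 + t powr 2 ^ j))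
        \<le> (\<Sum>j<M. 16 * (1 / 2) ^ j + 16 * (if y < 2 ^ j then y / 2 ^ j else 0))"
      by (intro sum_mono bound) simp
    also have "\<dots> = 16 * (\<Sum>j<M. (1 / 2) ^ j) + 16 * (\<Sum>j<M. if y < 2 ^ j then y / 2 ^ j else 0)"
      by (simp add: sum.distrib sum_distrib_left)
    also have "\<dots> \<le> 16 * 2 + 16 * 2"
    proof (intro add_mono mult_left_mono)
      show "(\<Sum>j<M. (1 / 2) ^ j) \<le> (2::real)"
        by (simp add: sum_gp_strict)
      have "max 0 (2 - 2 * y / 2 ^ M) \<le> 2"
        using y by simp
      then show "(\<Sum>j<M. if y < 2 ^ j then y / 2 ^ j else 0) \<le> 2"
        using sum_geometric_tail_le[OF y, of M] by linarith
    qed auto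
    finally show ?thesis
      by simp
  qed
  then show ?thesis
    unfolding eventually_at_top_linorder by blast
qed

lemma ratio_ge:
  assumes t: "t \<in> {2 powr height k..2 powr (height k + k)}"
  shows "1 / 8 \<le> L t / ln (1 + t)"
proof -
  define h where "h = real (height k)"
  have h: "real k + 2 \<le> h"
    unfolding h_def using height_ge[of k] by linarith
  have t1: "1 \<le> t"
    using t ge_one_powr_ge_zero[of 2 "real (height k)"] by simp
  have "2 ^ height k / 2 \<le> t"
    using t t1 by (simp add: powr_realpow)
  then have "h / 4 \<le> L t"
    unfolding h_def by (rule lower)
  moreover have "ln (1 + t) \<le> 2 * h"
  proof -
    have "ln (1 + t) \<le> ln (2 * 2 powr (h + k))"
      using t t1 by (simp add: h_def)
    also have "\<dots> = (h + k + 1) * ln 2"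
      by (simp add: ln_mult algebra_simps)
    also have "\<dots> \<le> (h + k + 1) * 1"
      using h ln_le_minus_one[of 2] by (intro mult_left_mono) auto
    finally show ?thesis
      using h by simp
  qed
  ultimately have "(h / 4) / (2 * h) \<le> L t / ln (1 + t)"
    using h t1 by (intro frac_le) auto
  then show ?thesis
    using h by simp
qed

lemma ratio_small:
  assumes t: "t \<in> {2 powr (128 * height k)..2 powr (128 * height k + k)}" and k: "255 \<le> k"
  shows "L t / ln (1 + t) \<le> 1 / 16"
proof -
  define h where "h = real (height k)"
  have h: "real k + 2 \<le> h"
    unfolding h_def using height_ge[of k] by linarith
  define u where "u = log 2 t"
  have "0 < t"
    using t by (auto intro: less_le_trans[of 0 "2 powr (128 * height k)"])
  then have u: "128 * h \<le> u" "u \<le> 128 * h + k" "t = 2 powr u"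
    using t by (auto simp: u_def h_def le_log_iff log_le_iff)
  have "2 * u \<le> 258 * h"
    using u h by simp
  also have "\<dots> \<le> (real k + 3) * h"
    using k h by (intro mult_right_mono) auto
  also have "\<dots> = height (Suc k)"
    by (simp add: height_Suc h_def)
  finally have "L (2 powr u) / ln (1 + 2 powr u) \<le> 2 * (real (\<Sum>n<Suc k. height n) + 4) / u"
    using u h by (intro ratio_le) auto
  also have "\<dots> \<le> (8 * h) / (128 * h)"
  proof (rule frac_le)
    have "real (\<Sum>n<Suc k. height n) \<le> 2 * h"
      using sum_height_le[of k] unfolding h_def
      by (metis add_mono_thms_linordered_semiring(1) lessThan_Suc mult_2 of_nat_add of_nat_le_iff order_refl sum.lessThan_Suc)
    then show "2 * (real (\<Sum>n<Suc k. height n) + 4) \<le> 8 * h"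
      using h by simp
  qed (use u h in auto)
  also have "\<dots> = 1 / 16"
    using h by simp
  finally show ?thesis
    using u(3) by simp
qed

end

section \<open>Generalized limits from logarithmic averages\<close>

text \<open>
  By compactness of products of intervals, a coordinatewise bounded sequence of functions has a
  cluster point.  Every continuous expression in finitely many coordinates that converges along the
  sequence takes its limit as its value at the cluster point, which is how linearity, positivity
  and invariance are inherited below.
\<close>

lemma coordinatewise_cluster_point:
  fixes A :: "nat \<Rightarrow> 'i \<Rightarrow> real"
  assumes "\<And>i. Bseq (\<lambda>k. A k i)"
  obtains \<omega> where "\<And>f l. continuous_on UNIV (f :: ('i \<Rightarrow> real) \<Rightarrow> real) \<Longrightarrow>
      (\<lambda>k. f (A k)) \<longlonglongrightarrow> l \<Longrightarrow> f \<omega> = l"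
proof -
  have "\<forall>i. \<exists>C. \<forall>k. \<bar>A k i\<bar> \<le> C"
    using assms unfolding Bseq_def by auto
  then obtain C where C: "\<And>k i. \<bar>A k i\<bar> \<le> C i"
    by metis
  define U where "U = (\<Pi>\<^sub>E i\<in>UNIV. {- C i..C i})"
  have "compactin (product_topology (\<lambda>i. euclidean) UNIV) U"
    unfolding U_def compactin_PiE by (simp add: compactin_euclidean_iff)
  then have "compact U"
    by (simp add: euclidean_product_topology compactin_euclidean_iff)
  moreover have "A k \<in> U" for k
    using C[of k] by (simp add: U_def PiE_iff abs_le_iff minus_le_iff)
  then have "eventually (\<lambda>\<phi>. \<phi> \<in> U) (filtermap A sequentially)"
    by (simp add: eventually_filtermap)
  moreover have "filtermap A sequentially \<noteq> bot"
    by (simp add: filtermap_bot_iff)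
  ultimately obtain \<omega> where \<omega>: "inf (nhds \<omega>) (filtermap A sequentially) \<noteq> bot"
    unfolding compact_filter by blast
  show ?thesis
  proof (rule that)
    fix f :: "('i \<Rightarrow> real) \<Rightarrow> real" and l
    assume "continuous_on UNIV f" and lim: "(\<lambda>k. f (A k)) \<longlonglongrightarrow> l"
    then have "open (f -` S)" if "open S" for S
      using open_vimage that by blast
    then have "(f \<longlongrightarrow> f \<omega>) (nhds \<omega>)"
      unfolding tendsto_def eventually_nhds by (metis vimage_eq)
    then have "(f \<longlongrightarrow> f \<omega>) (inf (nhds \<omega>) (filtermap A sequentially))"
      by (rule tendsto_mono[OF inf_le1])
    moreover have "(f \<longlongrightarrow> l) (filtermap A sequentially)"
      using lim by (simp add: filterlim_filtermap)
    then have "(f \<longlongrightarrow> l) (inf (nhds \<omega>) (filtermap A sequentially))"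
      by (rule tendsto_mono[OF inf_le2])
    ultimately show "f \<omega> = l"
      using tendsto_unique \<omega> by blast
  qed
qed

text \<open>The density of \<open>dt/t\<close> on \<open>[a, b]\<close>.\<close>

definition log_weight :: "real \<Rightarrow> real \<Rightarrow> real \<Rightarrow> real" where
  "log_weight a b t = indicator {a..b} t / t"

text \<open>The average of a function over \<open>[a, b]\<close> with respect to the measure \<open>dt/t\<close>.\<close>

definition log_avg :: "real \<Rightarrow> real \<Rightarrow> (real \<Rightarrow> real) \<Rightarrow> real" where
  "log_avg a b x = (\<integral>t. log_weight a b t * x t \<partial>lebesgue) / ln (b / a)"

lemma log_weight_eq_0: "0 < a \<Longrightarrow> t \<le> 0 \<Longrightarrow> log_weight a b t = 0"
  by (auto simp: log_weight_def indicator_def)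

lemma has_integral_log_weight:
  assumes "0 < a" "a \<le> b"
  shows "integrable lebesgue (log_weight a b)"
    and "(\<integral>t. log_weight a b t \<partial>lebesgue) = ln (b / a)"
proof -
  have eq: "log_weight a b = (\<lambda>t. 1 / t * indicator {a..b} t)"
    by (auto simp: log_weight_def)
  have meas: "(\<lambda>t. 1 / t * indicator {a..b} t) \<in> borel_measurable lborel"
    by measurable
  have cont: "isCont (\<lambda>t. 1 / t) t" if "a \<le> t" "t \<le> b" for t :: real
    using assms that by (intro continuous_intros) auto
  have der: "DERIV ln t :> 1 / t" if "a \<le> t" "t \<le> b" for t :: real
    using assms that by (auto intro!: derivative_eq_intros simp: divide_inverse)
  have int: "integrable lborel (\<lambda>t. 1 / t * indicator {a..b} t)"
    using integrable_FTC_Icc_nonneg[of "\<lambda>t. 1 / t" a b ln] assms der by auto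
  show "integrable lebesgue (log_weight a b)"
    unfolding eq using int integrable_completion[OF meas] by simp
  have "(\<integral>t. 1 / t * indicator {a..b} t \<partial>lborel) = ln b - ln a"
    using assms cont der by (intro integral_FTC_Icc_real) auto
  then show "(\<integral>t. log_weight a b t \<partial>lebesgue) = ln (b / a)"
    unfolding eq using integral_completion[OF meas] assms by (simp add: ln_div)
qed

lemma Linf_bound:
  assumes "x \<in> Linf"
  obtains C where "0 \<le> C" "AE t in lebesgue_on {0<..}. \<bar>x t\<bar> \<le> C"
proof -
  obtain C where "AE t in lebesgue_on {0<..}. \<bar>x t\<bar> \<le> C"
    using assms by (auto simp: Linf_def)
  then have "AE t in lebesgue_on {0<..}. \<bar>x t\<bar> \<le> max 0 C"
    by eventually_elim auto
  then show ?thesis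
    using that[of "max 0 C"] by simp
qed

lemma AE_pos_iff:
  "(AE t in lebesgue_on {0<..}. P t) \<longleftrightarrow> (AE t in lebesgue. 0 < t \<longrightarrow> P (t::real))"
  by (subst AE_restrict_space_iff) auto

lemma measurable_log_weight_mult:
  assumes "x \<in> borel_measurable (lebesgue_on {0<..})" "0 < a"
  shows "(\<lambda>t. log_weight a b t * x t) \<in> borel_measurable lebesgue"
proof -
  have "(\<lambda>t. indicator {0<..} t *\<^sub>R x t) \<in> borel_measurable lebesgue"
    using assms(1) by (subst (asm) borel_measurable_restrict_space_iff) auto
  moreover have "log_weight a b \<in> borel_measurable lebesgue"
    unfolding log_weight_def
    by (intro measurable_completion borel_measurable_divide) auto
  ultimately have "(\<lambda>t. log_weight a b t * (indicator {0<..} t *\<^sub>R x t)) \<in> borel_measurable lebesgue"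
    by (rule borel_measurable_times[rotated])
  also have "(\<lambda>t. log_weight a b t * (indicator {0<..} t *\<^sub>R x t)) = (\<lambda>t. log_weight a b t * x t)"
    using assms(2) by (auto simp: log_weight_def indicator_def)
  finally show ?thesis .
qed

lemma integrable_log_weight_mult:
  assumes "x \<in> Linf" "0 < a" "a \<le> b"
  shows "integrable lebesgue (\<lambda>t. log_weight a b t * x t)"
proof -
  obtain C where C: "0 \<le> C" "AE t in lebesgue_on {0<..}. \<bar>x t\<bar> \<le> C"
    using Linf_bound[OF assms(1)] .
  show ?thesis
  proof (rule Bochner_Integration.integrable_bound)
    show "integrable lebesgue (\<lambda>t. C * log_weight a b t)"
      using has_integral_log_weight(1)[OF assms(2,3)] by simp
    show "(\<lambda>t. log_weight a b t * x t) \<in> borel_measurable lebesgue"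
      using assms by (intro measurable_log_weight_mult) (auto simp: Linf_def)
    show "AE t in lebesgue. norm (log_weight a b t * x t) \<le> norm (C * log_weight a b t)"
      using C(2) unfolding AE_pos_iff
    proof eventually_elim
      case (elim t)
      show ?case
      proof (cases "t \<in> {a..b}")
        case True
        then show ?thesis
          using elim assms(2) C(1) by (simp add: abs_mult mult.commute mult_right_mono)
      qed (simp add: log_weight_def)
    qed
  qed
qed

lemma log_avg_add:
  assumes "x \<in> Linf" "y \<in> Linf" "0 < a" "a \<le> b"
  shows "log_avg a b (\<lambda>t. x t + y t) = log_avg a b x + log_avg a b y"
  unfolding log_avg_def using assms
  by (simp add: distrib_left integrable_log_weight_mult add_divide_distrib)

lemma log_avg_cmult: "log_avg a b (\<lambda>t. c * x t) = c * log_avg a b x"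
  by (simp add: log_avg_def mult.left_commute[of _ c])

lemma log_avg_cong_AE:
  assumes "x \<in> Linf" "y \<in> Linf" "0 < a" "AE t in lebesgue_on {0<..}. x t = y t"
  shows "log_avg a b x = log_avg a b y"
proof -
  have "(\<integral>t. log_weight a b t * x t \<partial>lebesgue) = (\<integral>t. log_weight a b t * y t \<partial>lebesgue)"
  proof (rule integral_cong_AE)
    show "AE t in lebesgue. log_weight a b t * x t = log_weight a b t * y t"
      using assms(4) unfolding AE_pos_iff
      by eventually_elim (use assms(3) in \<open>auto simp: log_weight_def indicator_def\<close>)
  qed (use assms in \<open>auto intro!: measurable_log_weight_mult simp: Linf_def\<close>)
  then show ?thesis
    by (simp add: log_avg_def)
qed

lemma log_avg_ge:
  assumes "x \<in> Linf" "0 < a" "a < b"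
    and "AE t in lebesgue_on {0<..}. t \<in> {a..b} \<longrightarrow> c \<le> x t"
  shows "c \<le> log_avg a b x"
proof -
  have "(\<integral>t. log_weight a b t * c \<partial>lebesgue) \<le> (\<integral>t. log_weight a b t * x t \<partial>lebesgue)"
  proof (rule integral_mono_AE)
    show "AE t in lebesgue. log_weight a b t * c \<le> log_weight a b t * x t"
      using assms(4) unfolding AE_pos_iff
      by eventually_elim
        (use assms(2) in \<open>auto simp: log_weight_def indicator_def divide_right_mono\<close>)
  qed (use assms in \<open>auto intro!: integrable_log_weight_mult has_integral_log_weight(1)\<close>)
  then have "ln (b / a) * c \<le> (\<integral>t. log_weight a b t * x t \<partial>lebesgue)"
    using has_integral_log_weight(2)[of a b] assms by simp
  moreover have "0 < ln (b / a)"
    using assms by simp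
  ultimately show ?thesis
    by (simp add: log_avg_def field_simps)
qed

lemma log_avg_le:
  assumes "x \<in> Linf" "0 < a" "a < b"
    and "AE t in lebesgue_on {0<..}. t \<in> {a..b} \<longrightarrow> x t \<le> c"
  shows "log_avg a b x \<le> c"
proof -
  have "(\<integral>t. log_weight a b t * x t \<partial>lebesgue) \<le> (\<integral>t. log_weight a b t * c \<partial>lebesgue)"
  proof (rule integral_mono_AE)
    show "AE t in lebesgue. log_weight a b t * x t \<le> log_weight a b t * c"
      using assms(4) unfolding AE_pos_iff
      by eventually_elim
        (use assms(2) in \<open>auto simp: log_weight_def indicator_def divide_right_mono\<close>)
  qed (use assms in \<open>auto intro!: integrable_log_weight_mult has_integral_log_weight(1)\<close>)
  then have "(\<integral>t. log_weight a b t * x t \<partial>lebesgue) \<le> ln (b / a) * c"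
    using has_integral_log_weight(2)[of a b] assms by simp
  moreover have "0 < ln (b / a)"
    using assms by simp
  ultimately show ?thesis
    by (simp add: log_avg_def field_simps)
qed

lemma log_avg_dilation:
  assumes x: "x \<in> Linf" "AE t in lebesgue_on {0<..}. \<bar>x t\<bar> \<le> C" "0 \<le> C"
    and "0 < a" "a < b" "0 < c"
  shows "\<bar>log_avg a b (\<lambda>t. x (c * t)) - log_avg a b x\<bar> \<le> 2 * C * \<bar>ln c\<bar> / ln (b / a)"
proof -
  define W where "W t = log_weight (min a (c * a)) (max a (c * a)) t
      + log_weight (min b (c * b)) (max b (c * b)) t" for t
  have pos: "0 < c * a" "c * a \<le> c * b" "0 < b" "0 < c * b" "0 < ln (b / a)"
    using assms by simp_all
  have ratio: "ln (max d (c * d) / min d (c * d)) = \<bar>ln c\<bar>" if "0 < d" for d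
  proof (cases "1 \<le> c")
    case True
    then show ?thesis
      using that by (simp add: max_def min_def)
  next
    case False
    then have "c * d < d"
      using that by simp
    then show ?thesis
      using that False \<open>0 < c\<close> by (simp add: max_def min_def ln_div)
  qed
  have part: "integrable lebesgue (log_weight (min d (c * d)) (max d (c * d)))"
    "(\<integral>t. log_weight (min d (c * d)) (max d (c * d)) t \<partial>lebesgue) = \<bar>ln c\<bar>" if "0 < d" for d
  proof -
    have "0 < min d (c * d)" "min d (c * d) \<le> max d (c * d)"
      using that \<open>0 < c\<close> by auto
    from has_integral_log_weight[OF this] ratio[OF that]
    show "integrable lebesgue (log_weight (min d (c * d)) (max d (c * d)))"
      "(\<integral>t. log_weight (min d (c * d)) (max d (c * d)) t \<partial>lebesgue) = \<bar>ln c\<bar>"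
      by simp_all
  qed
  have W: "integrable lebesgue W" "(\<integral>t. W t \<partial>lebesgue) = 2 * \<bar>ln c\<bar>"
    unfolding W_def using part[OF \<open>0 < a\<close>] part[OF \<open>0 < b\<close>] by simp_all
  have W_bound: "\<bar>log_weight (c * a) (c * b) t - log_weight a b t\<bar> \<le> W t" for t
  proof (cases "t \<le> 0")
    case True
    then show ?thesis
      using assms pos by (simp add: W_def log_weight_eq_0)
  next
    case False
    have "\<bar>indicator {c * a..c * b} t - indicator {a..b} t :: real\<bar>
        \<le> indicator {min a (c * a)..max a (c * a)} t + indicator {min b (c * b)..max b (c * b)} t"
      using assms(5) pos by (auto simp: indicator_def)
    then have "\<bar>indicator {c * a..c * b} t - indicator {a..b} t :: real\<bar> / t
        \<le> (indicator {min a (c * a)..max a (c * a)} t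
           + indicator {min b (c * b)..max b (c * b)} t) / t"
      using False by (intro divide_right_mono) auto
    then show ?thesis
      using False unfolding log_weight_def W_def
      by (simp add: diff_divide_distrib[symmetric] add_divide_distrib[symmetric])
  qed
  \<comment> \<open>The substitution \<open>t \<mapsto> c t\<close> leaves \<open>dt/t\<close> invariant and moves the interval.\<close>
  have "(\<integral>t. log_weight (c * a) (c * b) t * x t \<partial>lebesgue)
      = c * (\<integral>t. log_weight (c * a) (c * b) (c * t) * x (c * t) \<partial>lebesgue)"
    using lebesgue_integral_real_affine[of c "\<lambda>t. log_weight (c * a) (c * b) t * x t" 0] \<open>0 < c\<close>
    by simp
  also have "\<dots> = (\<integral>t. c * (log_weight (c * a) (c * b) (c * t) * x (c * t)) \<partial>lebesgue)"
    by simp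
  also have "(\<lambda>t. c * (log_weight (c * a) (c * b) (c * t) * x (c * t)))
      = (\<lambda>t. log_weight a b t * x (c * t))"
    using \<open>0 < c\<close> by (auto simp: log_weight_def indicator_def fun_eq_iff)
  finally have subst: "(\<integral>t. log_weight (c * a) (c * b) t * x t \<partial>lebesgue)
      = (\<integral>t. log_weight a b t * x (c * t) \<partial>lebesgue)" .
  have eq: "(\<integral>t. log_weight a b t * x (c * t) \<partial>lebesgue) - (\<integral>t. log_weight a b t * x t \<partial>lebesgue)
      = (\<integral>t. log_weight (c * a) (c * b) t * x t - log_weight a b t * x t \<partial>lebesgue)"
    unfolding subst[symmetric] using assms pos
    by (intro Bochner_Integration.integral_diff[symmetric] integrable_log_weight_mult) auto
  have "\<bar>(\<integral>t. log_weight a b t * x (c * t) \<partial>lebesgue) - (\<integral>t. log_weight a b t * x t \<partial>lebesgue)\<bar>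
      \<le> (\<integral>t. \<bar>log_weight (c * a) (c * b) t * x t - log_weight a b t * x t\<bar> \<partial>lebesgue)"
    unfolding eq by (rule integral_abs_bound)
  also have "\<dots> \<le> (\<integral>t. C * W t \<partial>lebesgue)"
  proof (rule integral_mono_AE)
    show "integrable lebesgue (\<lambda>t. \<bar>log_weight (c * a) (c * b) t * x t - log_weight a b t * x t\<bar>)"
      using assms pos
      by (intro integrable_abs Bochner_Integration.integrable_diff integrable_log_weight_mult) auto
    show "integrable lebesgue (\<lambda>t. C * W t)"
      using W by simp
    show "AE t in lebesgue. \<bar>log_weight (c * a) (c * b) t * x t - log_weight a b t * x t\<bar> \<le> C * W t"
      using x(2) unfolding AE_pos_iff
    proof eventually_elim
      case (elim t)
      have "\<bar>log_weight (c * a) (c * b) t * x t - log_weight a b t * x t\<bar>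
          = \<bar>log_weight (c * a) (c * b) t - log_weight a b t\<bar> * \<bar>x t\<bar>"
        by (simp add: left_diff_distrib[symmetric] abs_mult)
      also have "\<dots> \<le> W t * C"
      proof (cases "0 < t")
        case True
        then show ?thesis
          using elim W_bound[of t] by (intro mult_mono) auto
      next
        case False
        then have "log_weight (c * a) (c * b) t = 0" "log_weight a b t = 0"
          using pos(1) \<open>0 < a\<close> by (simp_all add: log_weight_eq_0)
        then show ?thesis
          using W_bound[of t] \<open>0 \<le> C\<close> by simp
      qed
      finally show ?case
        by (simp add: mult.commute)
    qed
  qed
  also have "\<dots> = 2 * C * \<bar>ln c\<bar>"
    using W by simp
  finally have "\<bar>(\<integral>t. log_weight a b t * x (c * t) \<partial>lebesgue) - (\<integral>t. log_weight a b t * x t \<partial>lebesgue)\<bar>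
      / ln (b / a) \<le> 2 * C * \<bar>ln c\<bar> / ln (b / a)"
    using pos by (intro divide_right_mono) auto
  then show ?thesis
    using pos(5) by (simp add: log_avg_def diff_divide_distrib[symmetric])
qed

text \<open>
  A cluster point of averages over intervals that move to infinity and whose logarithmic length
  grows without bound.
\<close>

lemma exists_dilation_invariant_limit:
  fixes a b :: "nat \<Rightarrow> real"
  assumes ab: "\<And>k. 0 < a k" "\<And>k. a k < b k"
    and a_lim: "filterlim a at_top sequentially"
    and b_lim: "filterlim (\<lambda>k. ln (b k / a k)) at_top sequentially"
  shows "\<exists>\<omega>. generalized_limit \<omega> \<and> dilation_invariant \<omega> \<and>
    (\<forall>x\<in>Linf. \<forall>c. (\<forall>\<^sub>F k in sequentially. \<forall>t\<in>{a k..b k}. c \<le> x t) \<longrightarrow> c \<le> \<omega> x) \<and>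
    (\<forall>x\<in>Linf. \<forall>c. (\<forall>\<^sub>F k in sequentially. \<forall>t\<in>{a k..b k}. x t \<le> c) \<longrightarrow> \<omega> x \<le> c)"
proof -
  define E where "E k x = log_avg (a k) (b k) x" for k x
  \<comment> \<open>Functions with unbounded averages are irrelevant; cutting them off makes all coordinates
    bounded.\<close>
  define A where "A k x = (if Bseq (\<lambda>k. E k x) then E k x else 0)" for k x
  have "Bseq (\<lambda>k. A k x)" for x
    by (cases "Bseq (\<lambda>k. E k x)") (auto simp: A_def)
  then obtain \<omega> where \<omega>: "\<And>f l. continuous_on UNIV (f :: ((real \<Rightarrow> real) \<Rightarrow> real) \<Rightarrow> real) \<Longrightarrow>
      (\<lambda>k. f (A k)) \<longlonglongrightarrow> l \<Longrightarrow> f \<omega> = l"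
    using coordinatewise_cluster_point[of A] by blast
  note coords = continuous_on_product_coordinates
  have E_bound: "Bseq (\<lambda>k. E k x)" if x: "x \<in> Linf" for x
  proof -
    obtain C where C: "0 \<le> C" "AE t in lebesgue_on {0<..}. \<bar>x t\<bar> \<le> C"
      using Linf_bound[OF x] .
    have "\<bar>E k x\<bar> \<le> C" for k
    proof -
      have "AE t in lebesgue_on {0<..}. t \<in> {a k..b k} \<longrightarrow> x t \<le> C"
        using C(2) by eventually_elim auto
      moreover have "AE t in lebesgue_on {0<..}. t \<in> {a k..b k} \<longrightarrow> - C \<le> x t"
        using C(2) by eventually_elim auto
      ultimately show ?thesis
        unfolding E_def using log_avg_ge[OF x ab] log_avg_le[OF x ab]
        by (simp add: abs_le_iff minus_le_iff)
    qed
    then show ?thesis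
      by (intro BseqI'[of _ C]) auto
  qed
  have A_E: "A k x = E k x" if "x \<in> Linf" for k x
    using E_bound[OF that] by (simp add: A_def)
  have ge: "c \<le> \<omega> x" if "x \<in> Linf" "\<forall>\<^sub>F k in sequentially. c \<le> E k x" for x c
  proof -
    have "(\<lambda>k. min (A k x) c) \<longlonglongrightarrow> c"
      using that(2) by (intro tendsto_eventually) (auto elim!: eventually_mono simp: A_E[OF that(1)])
    then have "min (\<omega> x) c = c"
      by (intro \<omega>[of "\<lambda>\<phi>. min (\<phi> x) c"] continuous_intros coords)
    then show ?thesis
      by linarith
  qed
  have le: "\<omega> x \<le> c" if "x \<in> Linf" "\<forall>\<^sub>F k in sequentially. E k x \<le> c" for x c
  proof -
    have "(\<lambda>k. max (A k x) c) \<longlonglongrightarrow> c"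
      using that(2) by (intro tendsto_eventually) (auto elim!: eventually_mono simp: A_E[OF that(1)])
    then have "max (\<omega> x) c = c"
      by (intro \<omega>[of "\<lambda>\<phi>. max (\<phi> x) c"] continuous_intros coords)
    then show ?thesis
      by linarith
  qed
  have ge': "c \<le> \<omega> x" if "x \<in> Linf" "\<forall>\<^sub>F k in sequentially. \<forall>t\<in>{a k..b k}. c \<le> x t" for x c
    using that(2)
    by (intro ge[OF that(1)]) (auto elim!: eventually_mono simp: E_def intro!: log_avg_ge that(1) ab AE_I2)
  have le': "\<omega> x \<le> c" if "x \<in> Linf" "\<forall>\<^sub>F k in sequentially. \<forall>t\<in>{a k..b k}. x t \<le> c" for x c
    using that(2)
    by (intro le[OF that(1)]) (auto elim!: eventually_mono simp: E_def intro!: log_avg_le that(1) ab AE_I2)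
  have one: "(\<lambda>t. 1) \<in> Linf"
    by (auto simp: Linf_def)
  have "generalized_limit \<omega>"
    unfolding generalized_limit_def
  proof (intro conjI ballI allI impI)
    fix x y assume xy: "x \<in> Linf" "y \<in> Linf" "AE t in lebesgue_on {0<..}. x t = y t"
    have "A k x = A k y" for k
      unfolding A_E[OF xy(1)] A_E[OF xy(2)] E_def
      using log_avg_cong_AE[OF xy(1,2) ab(1) xy(3)] .
    then have "\<omega> x - \<omega> y = 0"
      by (intro \<omega>[of "\<lambda>\<phi>. \<phi> x - \<phi> y"] continuous_intros coords) simp
    then show "\<omega> x = \<omega> y"
      by simp
  next
    fix x y assume xy: "x \<in> Linf" "y \<in> Linf"
    let ?z = "\<lambda>t. x t + y t"
    have E: "E k ?z = E k x + E k y" for k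
      using log_avg_add[OF xy ab(1) less_imp_le[OF ab(2)]] by (simp add: E_def)
    have "Bseq (\<lambda>k. E k ?z)"
    proof -
      obtain C D where "\<And>k. norm (E k x) \<le> C" "\<And>k. norm (E k y) \<le> D"
        using xy[THEN E_bound] unfolding Bseq_def by blast
      then have "norm (E k ?z) \<le> C + D" for k
        unfolding E by (rule norm_triangle_mono)
      then show ?thesis
        by (rule BseqI')
    qed
    then have "A k ?z = A k x + A k y" for k
      using E by (simp add: A_E[OF xy(1)] A_E[OF xy(2)]) (simp add: A_def E)
    then have "\<omega> ?z - (\<omega> x + \<omega> y) = 0"
      by (intro \<omega>[of "\<lambda>\<phi>. \<phi> ?z - (\<phi> x + \<phi> y)"] continuous_intros coords) simp
    then show "\<omega> ?z = \<omega> x + \<omega> y"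
      by simp
  next
    fix c x assume x: "x \<in> Linf"
    have E: "E k (\<lambda>t. c * x t) = c * E k x" for k
      by (simp add: E_def log_avg_cmult)
    have "Bseq (\<lambda>k. E k (\<lambda>t. c * x t))"
    proof -
      obtain C where "\<And>k. norm (E k x) \<le> C"
        using E_bound[OF x] unfolding Bseq_def by blast
      then have "norm (E k (\<lambda>t. c * x t)) \<le> \<bar>c\<bar> * C" for k
        unfolding E by (simp add: abs_mult mult_left_mono)
      then show ?thesis
        by (rule BseqI')
    qed
    then have "A k (\<lambda>t. c * x t) = c * A k x" for k
      by (simp add: A_E[OF x]) (simp add: A_def E)
    then have "\<omega> (\<lambda>t. c * x t) - c * \<omega> x = 0"
      by (intro \<omega>[of "\<lambda>\<phi>. \<phi> (\<lambda>t. c * x t) - c * \<phi> x"] continuous_intros coords) simp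
    then show "\<omega> (\<lambda>t. c * x t) = c * \<omega> x"
      by simp
  next
    fix x assume x: "x \<in> Linf" "AE t in lebesgue_on {0<..}. 0 \<le> x t"
    have "0 \<le> E k x" for k
    proof -
      have "AE t in lebesgue_on {0<..}. t \<in> {a k..b k} \<longrightarrow> 0 \<le> x t"
        using x(2) by eventually_elim simp
      then show ?thesis
        unfolding E_def by (rule log_avg_ge[OF x(1) ab])
    qed
    then show "0 \<le> \<omega> x"
      by (intro ge x) simp
  next
    show "\<omega> (\<lambda>t. 1) = 1"
      by (intro antisym ge' le' one) auto
  next
    fix x l assume x: "x \<in> Linf" "(x \<longlongrightarrow> l) at_top"
    have "\<bar>\<omega> x - l\<bar> \<le> e" if e: "0 < e" for e
    proof -
      obtain t0 where t0: "\<And>t. t0 \<le> t \<Longrightarrow> \<bar>x t - l\<bar> < e"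
        using tendstoD[OF x(2) e] by (auto simp: eventually_at_top_linorder dist_real_def)
      have "\<forall>\<^sub>F k in sequentially. t0 \<le> a k"
        using a_lim by (simp add: filterlim_at_top)
      then have "\<forall>\<^sub>F k in sequentially. \<forall>t\<in>{a k..b k}. l - e \<le> x t \<and> x t \<le> l + e"
      proof eventually_elim
        case (elim k)
        show ?case
        proof
          fix t assume "t \<in> {a k..b k}"
          then have "t0 \<le> t"
            using elim by simp
          from t0[OF this] show "l - e \<le> x t \<and> x t \<le> l + e"
            by linarith
        qed
      qed
      then have "l - e \<le> \<omega> x" "\<omega> x \<le> l + e"
        by (auto intro!: ge' le' x elim!: eventually_mono)
      then show ?thesis
        by linarith
    qed
    then show "\<omega> x = l"
      by (metis abs_le_zero_iff eq_iff_diff_eq_0 field_le_epsilon add_0)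
  qed
  moreover have "dilation_invariant \<omega>"
    unfolding dilation_invariant_def
  proof (intro ballI allI impI)
    fix x c assume x: "x \<in> Linf" and c: "(0::real) < c"
    let ?y = "\<lambda>t. x (c * t)"
    obtain C where C: "0 \<le> C" "AE t in lebesgue_on {0<..}. \<bar>x t\<bar> \<le> C"
      using Linf_bound[OF x] .
    have diff: "\<bar>E k ?y - E k x\<bar> \<le> 2 * C * \<bar>ln c\<bar> / ln (b k / a k)" for k
      unfolding E_def by (rule log_avg_dilation[OF x C(2,1) ab c])
    have "(\<lambda>k. 2 * C * \<bar>ln c\<bar> / ln (b k / a k)) \<longlonglongrightarrow> 0"
      by (intro tendsto_divide_0[OF tendsto_const] filterlim_at_top_imp_at_infinity b_lim)
    then have lim: "(\<lambda>k. E k ?y - E k x) \<longlonglongrightarrow> 0"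
      by (rule Lim_null_comparison[rotated]) (use diff in simp)
    have "Bseq (\<lambda>k. (E k ?y - E k x) + E k x)"
    proof -
      obtain D D' where "\<And>k. norm (E k ?y - E k x) \<le> D" "\<And>k. norm (E k x) \<le> D'"
        using convergent_imp_Bseq[OF convergentI[OF lim]] E_bound[OF x] unfolding Bseq_def by blast
      then have "norm ((E k ?y - E k x) + E k x) \<le> D + D'" for k
        by (rule norm_triangle_mono)
      then show ?thesis
        by (rule BseqI')
    qed
    then have "A k ?y - A k x = E k ?y - E k x" for k
      by (simp add: A_E[OF x]) (simp add: A_def)
    then have "\<omega> ?y - \<omega> x = 0"
      using lim by (intro \<omega>[of "\<lambda>\<phi>. \<phi> ?y - \<phi> x"] continuous_intros coords) simp
    then show "\<omega> ?y = \<omega> x"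
      by simp
  qed
  ultimately show ?thesis
    using ge' le' by (intro exI[of _ \<omega>]) simp
qed

lemma exists_limit_on_dyadic_windows:
  fixes g :: "nat \<Rightarrow> real"
  assumes g: "filterlim g at_top sequentially"
  shows "\<exists>\<omega>. generalized_limit \<omega> \<and> dilation_invariant \<omega> \<and>
    (\<forall>x\<in>Linf. \<forall>c. (\<forall>\<^sub>F k in sequentially. \<forall>t\<in>{2 powr g k..2 powr (g k + real k)}. c \<le> x t) \<longrightarrow> c \<le> \<omega> x) \<and>
    (\<forall>x\<in>Linf. \<forall>c. (\<forall>\<^sub>F k in sequentially. \<forall>t\<in>{2 powr g k..2 powr (g k + real k)}. x t \<le> c) \<longrightarrow> \<omega> x \<le> c)"
proof -
  have scaled: "filterlim (\<lambda>k. ln 2 * h k) at_top sequentially"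
    if "filterlim h at_top sequentially" for h :: "nat \<Rightarrow> real"
    by (intro filterlim_tendsto_pos_mult_at_top[OF tendsto_const _ that]) simp
  \<comment> \<open>The index is shifted because the window with index \<open>0\<close> is a single point.\<close>
  define a where "a k = 2 powr g (Suc k)" for k
  define b where "b k = 2 powr (g (Suc k) + real (Suc k))" for k
  have pos: "0 < a k" and less: "a k < b k" for k
    by (simp_all add: a_def b_def)
  have "filterlim (\<lambda>k. exp (ln 2 * g (Suc k))) at_top sequentially"
    by (intro filterlim_compose[OF exp_at_top] scaled filterlim_compose[OF g filterlim_Suc])
  then have a_lim: "filterlim a at_top sequentially"
    by (simp add: a_def[abs_def] powr_def mult.commute)
  have "ln (b k / a k) = ln 2 * real (Suc k)" for k
  proof -
    have "b k / a k = 2 powr real (Suc k)"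
      by (simp add: a_def b_def powr_diff[symmetric])
    then show ?thesis
      by simp
  qed
  then have len: "filterlim (\<lambda>k. ln (b k / a k)) at_top sequentially"
    using scaled[OF filterlim_compose[OF filterlim_real_sequentially filterlim_Suc]] by simp
  show ?thesis
    using exists_dilation_invariant_limit[OF pos less a_lim len]
    unfolding a_def b_def eventually_sequentially_Suc[where P = "\<lambda>k. \<forall>t\<in>{2 powr g k..2 powr (g k + real k)}. c \<le> x t" for c x]
      eventually_sequentially_Suc[where P = "\<lambda>k. \<forall>t\<in>{2 powr g k..2 powr (g k + real k)}. x t \<le> c" for c x] .
qed

section \<open>Exponentiation invariant limits\<close>

lemma Linf_borelI:
  assumes "x \<in> borel_measurable borel" "\<And>t. 0 < t \<Longrightarrow> \<bar>x t\<bar> \<le> C"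
  shows "x \<in> Linf"
proof -
  have "x \<in> borel_measurable lebesgue"
    using assms(1) by (intro measurable_completion) simp
  then have "x \<in> borel_measurable (lebesgue_on {0<..})"
    by (rule measurable_restrict_space1)
  moreover have "AE t in lebesgue_on {0<..}. \<bar>x t\<bar> \<le> C"
    unfolding AE_pos_iff using assms(2) by simp
  ultimately show ?thesis
    by (auto simp: Linf_def)
qed

lemma generalized_limit_le:
  assumes \<omega>: "generalized_limit \<omega>"
    and x: "x \<in> borel_measurable borel" "\<And>t. 0 < t \<Longrightarrow> \<bar>x t\<bar> \<le> D"
    and le: "\<forall>\<^sub>F t in at_top. x t \<le> C"
  shows "\<omega> x \<le> C"
proof -
  define z where "z t = max (x t - C) 0" for t
  have z_meas: "z \<in> borel_measurable borel"
    unfolding z_def using x(1) by measurable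
  have x_Linf: "x \<in> Linf"
    using x by (rule Linf_borelI)
  have z_Linf: "z \<in> Linf"
  proof (rule Linf_borelI[OF z_meas])
    show "\<bar>z t\<bar> \<le> D + \<bar>C\<bar>" if "0 < t" for t
      using x(2)[OF that] by (auto simp: z_def max_def)
  qed
  have one: "(\<lambda>t. 1) \<in> Linf" and minus: "(\<lambda>t. (- 1) * x t) \<in> Linf" and const: "(\<lambda>t. C * 1) \<in> Linf"
    and sum: "(\<lambda>t. z t + (- 1) * x t) \<in> Linf"
    and sum2: "(\<lambda>t. C * 1 + (z t + (- 1) * x t)) \<in> Linf"
  proof -
    show "(\<lambda>t. 1) \<in> Linf" "(\<lambda>t. C * 1) \<in> Linf"
      by (rule Linf_borelI[where C = "max 1 \<bar>C\<bar>"]; simp)+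
    show "(\<lambda>t. (- 1) * x t) \<in> Linf"
      by (rule Linf_borelI[where C = D]) (use x in auto)
    have b: "\<bar>z t\<bar> \<le> D + \<bar>C\<bar>" "\<bar>x t\<bar> \<le> D" if "0 < t" for t
      using x(2)[OF that] by (auto simp: z_def max_def)
    show "(\<lambda>t. z t + (- 1) * x t) \<in> Linf"
    proof (rule Linf_borelI[where C = "(D + \<bar>C\<bar>) + D"])
      show "\<bar>z t + (- 1) * x t\<bar> \<le> (D + \<bar>C\<bar>) + D" if "0 < t" for t
        using b[OF that] by linarith
    qed (use x z_meas in auto)
    show "(\<lambda>t. C * 1 + (z t + (- 1) * x t)) \<in> Linf"
    proof (rule Linf_borelI[where C = "\<bar>C\<bar> + ((D + \<bar>C\<bar>) + D)"])
      show "\<bar>C * 1 + (z t + (- 1) * x t)\<bar> \<le> \<bar>C\<bar> + ((D + \<bar>C\<bar>) + D)" if "0 < t" for t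
        using b[OF that] by linarith
    qed (use x z_meas in auto)
  qed
  have add: "\<And>x y. x \<in> Linf \<Longrightarrow> y \<in> Linf \<Longrightarrow> \<omega> (\<lambda>t. x t + y t) = \<omega> x + \<omega> y"
    and scale: "\<And>c x. x \<in> Linf \<Longrightarrow> \<omega> (\<lambda>t. c * x t) = c * \<omega> x"
    and pos: "\<And>x. x \<in> Linf \<Longrightarrow> (AE t in lebesgue_on {0<..}. 0 \<le> x t) \<Longrightarrow> 0 \<le> \<omega> x"
    and norm: "\<omega> (\<lambda>t. 1) = 1"
    and lim: "\<And>x l. x \<in> Linf \<Longrightarrow> (x \<longlongrightarrow> l) at_top \<Longrightarrow> \<omega> x = l"
    using \<omega> unfolding generalized_limit_def by blast+
  have "(z \<longlongrightarrow> 0) at_top"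
    using le by (intro tendsto_eventually) (auto elim!: eventually_mono simp: z_def)
  then have "\<omega> z = 0"
    by (rule lim[OF z_Linf])
  have "0 \<le> \<omega> (\<lambda>t. C * 1 + (z t + (- 1) * x t))"
    by (rule pos[OF sum2]) (simp add: z_def)
  also have "\<dots> = C * \<omega> (\<lambda>t. 1) + (\<omega> z + (- 1) * \<omega> x)"
    by (simp only: add[OF const sum] add[OF z_Linf minus] scale[OF one] scale[OF x_Linf])
  finally show ?thesis
    using norm \<open>\<omega> z = 0\<close> by simp
qed

text \<open>
  The limit assigns the same value to all functions \<open>x(t powr 2 ^ j)\<close>, so that \<open>M\<close> times this
  value is at most the bound \<open>C\<close>, for every \<open>M\<close>.
\<close>

lemma exponentiation_invariant_eq_0:
  assumes \<omega>: "generalized_limit \<omega>" "exponentiation_invariant \<omega>"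
    and x: "x \<in> borel_measurable borel" "\<And>t. 0 < t \<Longrightarrow> 0 \<le> x t" "\<And>t. 0 < t \<Longrightarrow> x t \<le> D"
    and sum_le: "\<And>M. \<forall>\<^sub>F t in at_top. (\<Sum>j<M. x (t powr 2 ^ j)) \<le> C"
  shows "\<omega> x = 0"
proof -
  have add: "\<And>x y. x \<in> Linf \<Longrightarrow> y \<in> Linf \<Longrightarrow> \<omega> (\<lambda>t. x t + y t) = \<omega> x + \<omega> y"
    and pos: "\<And>x. x \<in> Linf \<Longrightarrow> (AE t in lebesgue_on {0<..}. 0 \<le> x t) \<Longrightarrow> 0 \<le> \<omega> x"
    and lim: "\<And>x l. x \<in> Linf \<Longrightarrow> (x \<longlongrightarrow> l) at_top \<Longrightarrow> \<omega> x = l"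
    using \<omega>(1) unfolding generalized_limit_def by blast+
  have x_Linf: "x \<in> Linf"
    by (rule Linf_borelI[OF x(1)]) (use x in auto)
  have meas: "(\<lambda>t. \<Sum>j<M. x (t powr 2 ^ j)) \<in> borel_measurable borel" for M
    using x(1) by measurable
  have bound: "\<bar>\<Sum>j<M. x (t powr 2 ^ j)\<bar> \<le> M * D" if "0 < t" for M t
  proof -
    have "\<bar>\<Sum>j<M. x (t powr 2 ^ j)\<bar> \<le> (\<Sum>j<M. \<bar>x (t powr 2 ^ j)\<bar>)"
      by (rule sum_abs)
    also have "\<dots> \<le> (\<Sum>j<M. D)"
      using that x(2,3) by (intro sum_mono) auto
    finally show ?thesis
      by simp
  qed
  have sum: "\<omega> (\<lambda>t. \<Sum>j<M. x (t powr 2 ^ j)) = M * \<omega> x" for M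
  proof (induction M)
    case 0
    have "(\<lambda>t::real. 0::real) \<in> Linf"
      by (rule Linf_borelI[where C = 0]) simp_all
    then show ?case
      using lim[of "\<lambda>t. 0" 0] by simp
  next
    case (Suc M)
    have "(\<lambda>t. x (t powr 2 ^ M)) \<in> Linf"
      by (rule Linf_borelI[where C = D]) (use x in auto)
    moreover have "(\<lambda>t. \<Sum>j<M. x (t powr 2 ^ j)) \<in> Linf"
      using meas bound by (rule Linf_borelI)
    ultimately have "\<omega> (\<lambda>t. (\<Sum>j<M. x (t powr 2 ^ j)) + x (t powr 2 ^ M))
        = M * \<omega> x + \<omega> (\<lambda>t. x (t powr 2 ^ M))"
      using add Suc by simp
    also have "\<omega> (\<lambda>t. x (t powr 2 ^ M)) = \<omega> x"
      using \<omega>(2) x_Linf unfolding exponentiation_invariant_def by simp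
    finally show ?case
      by (simp add: algebra_simps)
  qed
  have "M * \<omega> x \<le> C" for M :: nat
    using generalized_limit_le[OF \<omega>(1) meas bound sum_le] sum by metis
  then have "\<omega> x \<le> 0"
    by (metis not_le reals_Archimedean3)
  moreover have "0 \<le> \<omega> x"
    by (rule pos[OF x_Linf]) (use x(2) in \<open>simp add: AE_pos_iff\<close>)
  ultimately show ?thesis
    by simp
qed

section \<open>The separating operator\<close>

theorem theorem8:
  assumes separable: "separable_space (euclidean :: 'h::chilbert_space topology)"
    and infinite_dim: "\<not> (\<exists>B::'h set. finite B \<and> cspan B = UNIV)"
  shows "\<exists>T\<^sub>0 :: 'h \<Rightarrow>\<^sub>L 'h. T\<^sub>0 \<in> dixmier_ideal \<and> positive_op T\<^sub>0 \<and>
           \<not> dixmier_measurable T\<^sub>0 \<and>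
           (\<forall>\<phi>\<in>exp_dixmier_traces. \<forall>\<psi>\<in>exp_dixmier_traces. \<phi> T\<^sub>0 = \<psi> T\<^sub>0)"
proof -
  have basis: "orthonormal_basis (SOME B :: 'h set. orthonormal_basis B)"
    using exists_orthonormal_basis[OF separable] by (rule someI_ex)
  obtain f :: "nat \<Rightarrow> 'h" where f: "inj f" "range f \<subseteq> (SOME B. orthonormal_basis B)"
    using infinite_countable_subset[OF infinite_orthonormal_basis[OF basis infinite_dim]] by blast
  interpret projection_series f weight "\<lambda>n. 2 ^ height n"
    by unfold_locales (use basis f in \<open>simp_all add: weight_nonneg summable_weight\<close>)
  have prod: "weight n * real (2 ^ height n) = height n" for n
    by (simp add: weight_def)
  interpret staircase "mu_int T"
  proof
    show "mu_int T t \<le> real (\<Sum>n<K. height n) + t * (\<Sum>n. weight (n + K))" if "0 \<le> t" for t K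
      using mu_int_T_le[OF that, of K] unfolding prod by simp
    show "height m / 4 \<le> mu_int T t" if "2 ^ height m / 2 \<le> t" for m t
      using mu_int_T_ge[of m t] that unfolding prod by simp
  qed
  let ?F = "log_mean T"
  have F_nonneg: "0 \<le> ?F t" and F_le: "?F t \<le> 16" if "0 < t" for t
    using that ratio_bounded[OF that] mu_int_nonneg[of T t] by (simp_all add: log_mean_eq)
  have F_Linf: "?F \<in> Linf"
    by (rule Linf_borelI[OF borel_measurable_log_mean, where C = 16]) (use F_nonneg F_le in auto)
  have ideal: "T \<in> dixmier_ideal"
    using T_BH F_le by (auto simp: dixmier_ideal_def intro!: bdd_aboveI[of _ 16])
  have Tr: "Tr \<omega> T = complex_of_real (\<omega> ?F)" for \<omega>
    using ideal positive_T by (simp add: Tr_def)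
  have "\<phi> T = 0" if \<phi>_in: "\<phi> \<in> exp_dixmier_traces" for \<phi>
  proof -
    obtain \<omega> where \<phi>: "\<phi> = Tr \<omega>" and \<omega>: "generalized_limit \<omega>" "exponentiation_invariant \<omega>"
      using \<phi>_in unfolding exp_dixmier_traces_def by blast
    have "\<omega> ?F = 0"
      using F_nonneg F_le ratio_sum_le
      by (intro exponentiation_invariant_eq_0[OF \<omega> borel_measurable_log_mean]) (auto simp: log_mean_eq)
    then show ?thesis
      by (simp add: \<phi> Tr)
  qed
  moreover have "\<not> dixmier_measurable T"
  proof
    assume meas: "dixmier_measurable T"
    \<comment> \<open>In the variable \<open>log 2 t\<close>, the mean is large just after each height, and small after 128
      times the height, where the next one is still far away.\<close>
    have height_lim: "filterlim (\<lambda>k. real (height k)) at_top sequentially"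
    proof (rule filterlim_at_top_mono[OF filterlim_real_sequentially], intro always_eventually allI)
      show "real k \<le> real (height k)" for k
        using height_ge[of k] by linarith
    qed
    have height_lim': "filterlim (\<lambda>k. real (128 * height k)) at_top sequentially"
      by (rule filterlim_at_top_mono[OF height_lim]) simp
    obtain \<omega> where \<omega>: "generalized_limit \<omega>" "dilation_invariant \<omega>"
      and ge: "\<forall>x\<in>Linf. \<forall>c. (\<forall>\<^sub>F k in sequentially.
        \<forall>t\<in>{2 powr real (height k)..2 powr (real (height k) + real k)}. c \<le> x t) \<longrightarrow> c \<le> \<omega> x"
      using exists_limit_on_dyadic_windows[OF height_lim] by (elim exE conjE) (rule that)
    obtain \<omega>' where \<omega>': "generalized_limit \<omega>'" "dilation_invariant \<omega>'"
      and le: "\<forall>x\<in>Linf. \<forall>c. (\<forall>\<^sub>F k in sequentially.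
        \<forall>t\<in>{2 powr real (128 * height k)..2 powr (real (128 * height k) + real k)}. x t \<le> c)
        \<longrightarrow> \<omega>' x \<le> c"
      using exists_limit_on_dyadic_windows[OF height_lim'] by (elim exE conjE) (rule that)
    have "1 / 8 \<le> \<omega> ?F"
      using ratio_ge by (intro ge[rule_format] F_Linf) (simp add: log_mean_eq)
    moreover have "\<omega>' ?F \<le> 1 / 16"
      using ratio_small
      by (intro le[rule_format] F_Linf eventually_sequentiallyI[of 255]) (simp add: log_mean_eq)
    moreover have "Tr \<omega> T = Tr \<omega>' T"
      using meas \<omega> \<omega>' unfolding dixmier_measurable_def dixmier_traces_def by blast
    ultimately show False
      by (simp add: Tr)
  qed
  ultimately show ?thesis
    using ideal positive_T by metis
qed

end
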